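(* Assume Ostaszewski's principle $\clubsuit$. Then there exists a locally compact Hausdorff space $L$ in the class $\mathcal{S}$ with height $\omega$ and having the collapsing property.
   Context: Let $\mathcal{L}(\omega_1)$ be the set of all nonzero countable limit ordinals. Ostaszewski's principle $\clubsuit$: there exists a collection $\{F_\alpha : \alpha \in \mathcal{L}(\omega_1)\}$ such that (1) $F_\alpha \subset \alpha$ and $\sup F_\alpha = \alpha$ for each $\alpha \in \mathcal{L}(\omega_1)$; (2) for every uncountable $\mathcal{A} \subset \omega_1$ there is $\alpha \in \mathcal{L}(\omega_1)$ with $F_\alpha \subset \mathcal{A}$. The class $\mathcal{S}$ consists of all locally compact Hausdorff spaces $L$ for which there is a continuous surjection $\varphi:L\to\omega_1$ ($\omega_1$ with the order topology) such that $\varphi^{-1}[\{\alpha\}]$ is finite for every $\alpha<\omega_1$. Every member of $\mathcal{S}$ is scattered; its height is the least ordinal $\rho$ such that the $\rho$-th Cantor–Bendixson derivative $L^{(\rho)}$ is empty. $K=L\cup\{\infty\}$ is the one-point compactification of $L$. Collapsing property. A collection of ordered $k$-tuples $\{(G_1^\lambda,\ldots,G_k^\lambda):\lambda\in\Gamma\}$ is $k$-separated in $L$ if there are non-zero natural numbers $m_1,\ldots,m_k$ such that each $G_j^\lambda$ is a subset of $L$ with exactly $m_j$ elements, and $G_j^\lambda\cap G_i^\gamma=\emptyset$ whenever $i\neq j$ or $\lambda\neq\gamma$. If $\{I_1,\ldots,I_k\}$ is a partition of $\{1,\ldots,m\}$, a collection $\{(x_1^\lambda,\ldots,x_m^\lambda):\lambda\in\Gamma\}\subset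 L^m$ is $(I_1,\ldots,I_k)$-separated if the family of tuples $(G_1^\lambda,\ldots,G_k^\lambda)$ with $G_j^\lambda=\{x_i^\lambda:i\in I_j\}$ is $k$-separated in $L$. Such a collection collapses if it has an accumulation point $(q_1,\ldots,q_m)\in K^m$ such that, for some distinct points $a_1,\ldots,a_k\in K$ with $a_k=\infty$, one has $\{q_i:i\in I_j\}=\{a_j\}$ for every $1\le j\le k$. $L$ has the collapsing property if for every integer $m\geq 1$ and every partition $\{I_1,\ldots,I_k\}$ of $\{1,\ldots,m\}$, every uncountable $(I_1,\ldots,I_k)$-separated subset of $L^m$ collapses. *)

theory Defs
  imports "HOL-Analysis.Analysis"
begin

section \<open>The ordinal \<open>\<omega>\<^sub>1\<close>\<close>

text \<open>A value \<open>\<alpha>\<close> of the following type is a countable ordinal; the ordinal \<open>\<alpha>\<close>, viewed as the set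
  of its predecessors, is \<open>{..<\<alpha>}\<close>, and \<open>\<omega>\<^sub>1\<close> as a set is \<open>UNIV\<close>.\<close>

lemma Card_order_cardSuc_natLeq: "Card_order (cardSuc natLeq)"
  by (simp add: cardSuc_Card_order natLeq_Card_order)

lemma uncountable_Field_cardSuc_natLeq:
  includes cardinal_syntax
  shows "uncountable (Field (cardSuc natLeq))"
proof
  assume "countable (Field (cardSuc natLeq))"
  then have "|Field (cardSuc natLeq)| \<le>o |UNIV :: nat set|"
    by (auto simp: countable_def card_of_ordLeq[symmetric])
  then have "cardSuc natLeq \<le>o natLeq"
    using card_of_Field_ordIso[OF Card_order_cardSuc_natLeq] card_of_nat
    by (meson ordIso_ordLeq_trans ordIso_symmetric ordLeq_ordIso_trans)
  then show False
    using cardSuc_greater[OF natLeq_Card_order] not_ordLess_ordLeq by blast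
qed

typedef omega1 = "Field (cardSuc natLeq)"
  using uncountable_Field_cardSuc_natLeq by (metis countable_empty ex_in_conv)

instantiation omega1 :: wellorder
begin

definition less_eq_omega1 :: "omega1 \<Rightarrow> omega1 \<Rightarrow> bool" where
  "\<alpha> \<le> \<beta> \<longleftrightarrow> (Rep_omega1 \<alpha>, Rep_omega1 \<beta>) \<in> cardSuc natLeq"

definition less_omega1 :: "omega1 \<Rightarrow> omega1 \<Rightarrow> bool" where
  "\<alpha> < \<beta> \<longleftrightarrow> \<alpha> \<le> \<beta> \<and> \<not> \<beta> \<le> (\<alpha> :: omega1)"

instance
proof -
  let ?r = "cardSuc natLeq"
  have wo: "Well_order ?r"
    using Card_order_cardSuc_natLeq by (simp add: card_order_on_def)
  then have refl: "Refl ?r" and tr: "trans ?r" and as: "antisym ?r" and tot: "Total ?r"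
    and wf: "wf (?r - Id)"
    by (auto simp: order_on_defs)
  show "OFCLASS(omega1, wellorder_class)"
  proof
    fix x y z :: omega1
    show "(x < y) = (x \<le> y \<and> \<not> y \<le> x)"
      by (simp add: less_omega1_def)
    show "x \<le> x"
      using refl Rep_omega1 by (auto simp: less_eq_omega1_def refl_on_def)
    show "x \<le> y \<Longrightarrow> y \<le> z \<Longrightarrow> x \<le> z"
      using tr unfolding less_eq_omega1_def trans_def by blast
    show anti: "x \<le> y \<Longrightarrow> y \<le> x \<Longrightarrow> x = y"
      using as unfolding less_eq_omega1_def antisym_def by (metis Rep_omega1_inject)
    show "x \<le> y \<or> y \<le> x"
      using tot refl Rep_omega1[of x] Rep_omega1[of y]
      unfolding less_eq_omega1_def total_on_def refl_on_def by metis
  next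
    fix P :: "omega1 \<Rightarrow> bool" and a :: omega1
    assume step: "\<And>x. (\<And>y. y < x \<Longrightarrow> P y) \<Longrightarrow> P x"
    have "{(x, y). x < (y :: omega1)} \<subseteq> inv_image (?r - Id) Rep_omega1"
      using refl Rep_omega1
      by (auto simp: less_omega1_def less_eq_omega1_def Rep_omega1_inject)
    then have "wf {(x, y). x < (y :: omega1)}"
      using wf wf_inv_image wf_subset by blast
    then show "P a"
      by (rule wf_induct_rule) (use step in auto)
  qed
qed

end

lemma uncountable_UNIV_omega1: "uncountable (UNIV :: omega1 set)"
  using uncountable_Field_cardSuc_natLeq type_definition.Rep_range[OF type_definition_omega1]
  by (metis countable_image)

lemma countable_lessThan_omega1:
  includes cardinal_syntax
  shows "countable {..<(\<alpha> :: omega1)}"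
proof -
  let ?r = "cardSuc natLeq"
  have "Rep_omega1 ` {..<\<alpha>} \<subseteq> underS ?r (Rep_omega1 \<alpha>)"
    by (auto simp: underS_def less_omega1_def less_eq_omega1_def Rep_omega1_inject)
  moreover have "countable (underS ?r (Rep_omega1 \<alpha>))"
  proof -
    have "|underS ?r (Rep_omega1 \<alpha>)| <o ?r"
      by (rule card_of_underS[OF Card_order_cardSuc_natLeq Rep_omega1])
    then have "|underS ?r (Rep_omega1 \<alpha>)| \<le>o natLeq"
      using cardSuc_ordLeq_ordLess[OF natLeq_Card_order card_of_Card_order] by blast
    then have "|underS ?r (Rep_omega1 \<alpha>)| \<le>o |UNIV :: nat set|"
      using card_of_nat ordIso_symmetric ordLeq_ordIso_trans by blast
    then show ?thesis
      by (auto simp: countable_def card_of_ordLeq[symmetric])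
  qed
  ultimately have "countable (Rep_omega1 ` {..<\<alpha>})"
    using countable_subset by blast
  then show ?thesis
    by (rule countable_image_inj_on) (simp add: inj_on_def Rep_omega1_inject)
qed

instantiation omega1 :: linorder_topology
begin

definition open_omega1 :: "omega1 set \<Rightarrow> bool" where
  "open_omega1 = generate_topology (range (\<lambda>\<alpha>. {..<\<alpha>}) \<union> range (\<lambda>\<alpha>. {\<alpha><..}))"

instance
  by standard (rule open_omega1_def)

end

definition is_limit :: "'i::wellorder \<Rightarrow> bool" where
  "is_limit \<alpha> \<longleftrightarrow> (\<exists>\<beta>. \<beta> < \<alpha>) \<and> (\<forall>\<beta><\<alpha>. \<exists>\<gamma>. \<beta> < \<gamma> \<and> \<gamma> < \<alpha>)"

text \<open>The ordinal \<open>\<omega>\<close>.\<close>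

definition omega :: omega1 where
  "omega = (LEAST \<alpha>. is_limit \<alpha>)"

section \<open>Ostaszewski's principle\<close>

definition clubsuit :: bool where
  "clubsuit \<longleftrightarrow> (\<exists>F :: omega1 \<Rightarrow> omega1 set.
     (\<forall>\<alpha>. is_limit \<alpha> \<longrightarrow> F \<alpha> \<subseteq> {..<\<alpha>} \<and> (LEAST \<beta>. \<forall>\<gamma>\<in>F \<alpha>. \<gamma> \<le> \<beta>) = \<alpha>) \<and>
     (\<forall>A. uncountable A \<longrightarrow> (\<exists>\<alpha>. is_limit \<alpha> \<and> F \<alpha> \<subseteq> A)))"

section \<open>Cantor--Bendixson derivatives and height\<close>

lemma INT_lessThan_cong [fundef_cong]:
  "\<lbrakk>\<rho> = \<rho>'; \<And>\<sigma>. \<sigma> < \<rho>' \<Longrightarrow> f \<sigma> = g \<sigma>\<rbrakk> \<Longrightarrow> (\<Inter>\<sigma>\<in>{..<\<rho>}. f \<sigma>) = (\<Inter>\<sigma>\<in>{..<\<rho>'}. g \<sigma>)"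
  by auto

text \<open>The zero, successor and limit clauses of the usual recursion are merged into one equation and
  recovered below.\<close>

function cb_derivative :: "'a topology \<Rightarrow> 'i::wellorder \<Rightarrow> 'a set" where
  "cb_derivative X \<rho> =
     topspace X \<inter> (\<Inter>\<sigma>\<in>{..<\<rho>}. cb_derivative X \<sigma> \<inter> X derived_set_of (cb_derivative X \<sigma>))"
  by auto
termination
  by (relation "inv_image {(\<sigma>, \<rho>). \<sigma> < \<rho>} snd") (auto simp: wf)

declare cb_derivative.simps [simp del]

lemma cb_derivative_antimono: "\<sigma> \<le> \<rho> \<Longrightarrow> cb_derivative X \<rho> \<subseteq> cb_derivative X \<sigma>"
  by (subst (1 2) cb_derivative.simps) auto

lemma cb_derivative_zero:
  assumes "\<And>\<sigma>. \<rho> \<le> \<sigma>"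
  shows "cb_derivative X \<rho> = topspace X"
proof -
  have "{..<\<rho>} = {}"
    using assms by (metis (no_types) ex_in_conv lessThan_iff not_less)
  then show ?thesis
    by (subst cb_derivative.simps) auto
qed

lemma cb_derivative_successor:
  assumes "\<sigma> < \<rho>" and "\<And>\<tau>. \<tau> < \<rho> \<Longrightarrow> \<tau> \<le> \<sigma>"
  shows "cb_derivative X \<rho> = cb_derivative X \<sigma> \<inter> X derived_set_of (cb_derivative X \<sigma>)"
proof -
  let ?D = "\<lambda>\<tau>. cb_derivative X \<tau> \<inter> X derived_set_of (cb_derivative X \<tau>)"
  have "?D \<sigma> \<subseteq> ?D \<tau>" if "\<tau> < \<rho>" for \<tau>
    using cb_derivative_antimono[OF assms(2)[OF that], of X] derived_set_of_mono by blast
  then have "(\<Inter>\<tau>\<in>{..<\<rho>}. ?D \<tau>) = ?D \<sigma>"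
    using assms(1) by blast
  moreover have "?D \<sigma> \<subseteq> topspace X"
    using derived_set_of_subset_topspace by fast
  ultimately show ?thesis
    by (subst cb_derivative.simps) auto
qed

lemma cb_derivative_limit:
  assumes "is_limit \<rho>"
  shows "cb_derivative X \<rho> = (\<Inter>\<sigma>\<in>{..<\<rho>}. cb_derivative X \<sigma>)"
proof
  show "cb_derivative X \<rho> \<subseteq> (\<Inter>\<sigma>\<in>{..<\<rho>}. cb_derivative X \<sigma>)"
    by (meson INT_greatest cb_derivative_antimono lessThan_iff less_imp_le)
  show "(\<Inter>\<sigma>\<in>{..<\<rho>}. cb_derivative X \<sigma>) \<subseteq> cb_derivative X \<rho>"
  proof
    fix x assume x: "x \<in> (\<Inter>\<sigma>\<in>{..<\<rho>}. cb_derivative X \<sigma>)"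
    obtain \<beta> where "\<beta> < \<rho>"
      using assms by (auto simp: is_limit_def)
    then have "x \<in> topspace X"
      using x cb_derivative.simps[of X \<beta>] by blast
    moreover have "x \<in> cb_derivative X \<sigma> \<inter> X derived_set_of (cb_derivative X \<sigma>)" if "\<sigma> < \<rho>" for \<sigma>
    proof -
      obtain \<gamma> where "\<sigma> < \<gamma>" "\<gamma> < \<rho>"
        using assms \<open>\<sigma> < \<rho>\<close> unfolding is_limit_def by blast
      then show ?thesis
        using x cb_derivative.simps[of X \<gamma>] by blast
    qed
    ultimately show "x \<in> cb_derivative X \<rho>"
      by (subst cb_derivative.simps) auto
  qed
qed

definition has_height :: "'a topology \<Rightarrow> 'i::wellorder \<Rightarrow> bool" where
  "has_height X \<rho> \<longleftrightarrow> cb_derivative X \<rho> = {} \<and> (\<forall>\<sigma><\<rho>. cb_derivative X \<sigma> \<noteq> {})"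

section \<open>The class \<open>\<S>\<close>\<close>

text \<open>A member \<open>L\<close> of the class embeds as a set into \<open>omega1 \<times> nat\<close>, by pairing \<open>\<phi> x\<close> with the
  position of \<open>x\<close> in its finite fibre.  Hence asserting the existence of a member over that type is no
  restriction.\<close>

definition class_S :: "'a topology \<Rightarrow> bool" where
  "class_S L \<longleftrightarrow> locally_compact_space L \<and> Hausdorff_space L \<and>
     (\<exists>\<phi> :: 'a \<Rightarrow> omega1. continuous_map L euclidean \<phi> \<and> \<phi> ` topspace L = UNIV \<and>
        (\<forall>\<alpha>. finite {x \<in> topspace L. \<phi> x = \<alpha>}))"

section \<open>The collapsing property\<close>

text \<open>An \<open>m\<close>-tuple over \<open>S\<close> is an element of \<open>{1..m} \<rightarrow>\<^sub>E S\<close>, and the one-point compactification of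
  \<open>L\<close> is \<open>Alexandroff_compactification L\<close>, in which \<open>x\<close> becomes \<open>Some x\<close> and \<open>\<infinity>\<close> is \<open>None\<close>.\<close>

definition k_separated :: "'a topology \<Rightarrow> nat \<Rightarrow> 'l set \<Rightarrow> ('l \<Rightarrow> nat \<Rightarrow> 'a set) \<Rightarrow> bool" where
  "k_separated L k \<Gamma> G \<longleftrightarrow>
     (\<exists>m :: nat \<Rightarrow> nat. (\<forall>j\<in>{1..k}. m j \<noteq> 0) \<and>
        (\<forall>\<eta>\<in>\<Gamma>. \<forall>j\<in>{1..k}. G \<eta> j \<subseteq> topspace L \<and> finite (G \<eta> j) \<and> card (G \<eta> j) = m j)) \<and>
     (\<forall>\<eta>\<in>\<Gamma>. \<forall>\<gamma>\<in>\<Gamma>. \<forall>i\<in>{1..k}. \<forall>j\<in>{1..k}. i \<noteq> j \<or> \<eta> \<noteq> \<gamma> \<longrightarrow> G \<eta> j \<inter> G \<gamma> i = {})"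

definition ordered_partition :: "nat \<Rightarrow> nat \<Rightarrow> (nat \<Rightarrow> nat set) \<Rightarrow> bool" where
  "ordered_partition m k I \<longleftrightarrow> inj_on I {1..k} \<and> partition_on {1..m} (I ` {1..k})"

text \<open>A collection of tuples is a set of tuples, indexed by itself.  Separatedness makes the tuples
  of an indexed collection pairwise distinct, so this loses no generality.\<close>

definition partition_separated ::
    "'a topology \<Rightarrow> nat \<Rightarrow> (nat \<Rightarrow> nat set) \<Rightarrow> (nat \<Rightarrow> 'a) set \<Rightarrow> bool" where
  "partition_separated L k I A \<longleftrightarrow> k_separated L k A (\<lambda>x j. x ` I j)"

definition collapses ::
    "'a topology \<Rightarrow> nat \<Rightarrow> nat \<Rightarrow> (nat \<Rightarrow> nat set) \<Rightarrow> (nat \<Rightarrow> 'a) set \<Rightarrow> bool" where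
  "collapses L m k I A \<longleftrightarrow>
     (\<exists>q \<in> product_topology (\<lambda>_. Alexandroff_compactification L) {1..m}
             derived_set_of ((\<lambda>x. \<lambda>i\<in>{1..m}. Some (x i)) ` A).
        \<exists>a. a ` {1..k} \<subseteq> topspace (Alexandroff_compactification L) \<and> inj_on a {1..k} \<and>
            a k = None \<and> (\<forall>j\<in>{1..k}. q ` I j = {a j}))"

definition collapsing_property :: "'a topology \<Rightarrow> bool" where
  "collapsing_property L \<longleftrightarrow>
     (\<forall>m\<ge>1. \<forall>k I. ordered_partition m k I \<longrightarrow>
        (\<forall>A \<subseteq> {1..m} \<rightarrow>\<^sub>E topspace L.
           uncountable A \<and> partition_separated L k I A \<longrightarrow> collapses L m k I A))"

end

theory Submission
  imports Defs
begin

text \<open>The space lives on the points \<open>(\<alpha>, j)\<close> with \<open>j \<le> width \<alpha>\<close>, where \<open>width \<alpha>\<close> is finite and the map to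
\<open>\<omega>\<^sub>1\<close> is the first coordinate, here called the level of a point.  It is built by recursion on the level.
Above the levels below \<open>\<alpha>\<close> one is free to choose finitely many new points \<open>(\<alpha>, 1), (\<alpha>, 2), \<dots>\<close> and to let
each of them be the limit of a sequence of finite sets of old points whose levels climb to \<open>\<alpha>\<close>: the
basic neighbourhoods of the new point are the tails of a sequence of compact open neighbourhoods of
these finite sets.  If the neighbourhoods are shrunk enough to be pairwise disjoint, the new points have
disjoint neighbourhoods, and any further finite sets that climb to \<open>\<alpha>\<close> and avoid those neighbourhoods
accumulate nowhere, that is, they converge to \<open>\<infinity>\<close>.

So a sequence of finite sets of points labelled by natural numbers is an instruction: the points with
label \<open>j \<ge> 1\<close> shall converge to \<open>(\<alpha>, j)\<close>, and those with label \<open>0\<close> to \<open>\<infinity>\<close>.  Ostaszewski's principle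
supplies the instructions.  It speaks of sets of ordinals, but finite sets of labelled points can be coded by
ordinals, and after thinning an uncountable disjoint family to an \<open>\<omega>\<^sub>1\<close>-sequence in which levels and
codes interleave, any guess for its set of codes decodes to a sequence that climbs
(\<open>clubsuit_guesses_sequences\<close>).  Hence for every uncountable family of pairwise disjoint finite labelled
sets some level obeys an instruction taken from that family (\<open>catch\<close>).  Labelling the
coordinates of a tuple by the block that contains them, with label \<open>0\<close> for the last block, turns this into
the collapsing property.

For the height, every point carries a natural number, its rank, that exceeds the ranks of the other points
in its basic neighbourhoods; an instruction is obeyed only if the ranks that occur in it are bounded, and an
uncountable family always has an uncountable subfamily with bounded ranks.  The rank is an upper bound for
the Cantor--Bendixson rank, so the \<open>\<omega>\<close>-th derivative is empty.  That no finite derivative is empty follows by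
induction: if a derivative is unbounded in \<open>\<omega>\<^sub>1\<close>, the family of its singletons with label \<open>1\<close> is caught at
some level, and the limit point lies in the next derivative, again at arbitrarily large levels.\<close>

section \<open>Guessing sequences of finite sets\<close>

lemma inj_pairing_omega1:
  includes cardinal_syntax
  obtains p :: "omega1 \<times> omega1 \<Rightarrow> omega1" where "inj p"
proof -
  have "infinite (UNIV :: omega1 set)"
    using uncountable_UNIV_omega1 uncountable_infinite by blast
  then have "|UNIV \<times> UNIV :: (omega1 \<times> omega1) set| =o |UNIV :: omega1 set|"
    by (rule card_of_Times_same_infinite)
  then have "\<exists>p :: omega1 \<times> omega1 \<Rightarrow> omega1. bij_betw p (UNIV \<times> UNIV) UNIV"
    by (simp add: card_of_ordIso)
  then show thesis
    using that by (auto simp: bij_betw_def)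
qed

text \<open>The empty list and the nonempty lists are told apart by the two tags \<open>a\<close> and \<open>b\<close>.\<close>

primrec list_code :: "'b \<Rightarrow> 'b \<Rightarrow> ('b \<times> 'b \<Rightarrow> 'b) \<Rightarrow> ('a \<Rightarrow> 'b) \<Rightarrow> 'a list \<Rightarrow> 'b" where
  "list_code a b p g [] = p (a, a)"
| "list_code a b p g (x # xs) = p (b, p (g x, list_code a b p g xs))"

lemma inj_list_code:
  assumes "inj p" "inj g" "a \<noteq> b"
  shows "inj (list_code a b p g)"
proof (rule injI)
  fix xs ys
  show "list_code a b p g xs = list_code a b p g ys \<Longrightarrow> xs = ys"
  proof (induction xs arbitrary: ys)
    case Nil
    then show ?case using assms by (cases ys) (auto simp: inj_eq)
  next
    case (Cons x xs)
    then show ?case using assms by (cases ys) (auto simp: inj_eq)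
  qed
qed

lemma finite_set_code:
  fixes g :: "'a \<Rightarrow> omega1"
  assumes "inj g"
  obtains code :: "'a set \<Rightarrow> omega1" where "inj_on code {S. finite S}"
proof -
  obtain p :: "omega1 \<times> omega1 \<Rightarrow> omega1" where p: "inj p"
    by (rule inj_pairing_omega1)
  obtain a b :: omega1 where ab: "a \<noteq> b"
    using uncountable_UNIV_omega1 
    by (metis (full_types) UNIV_eq_I countable_empty countable_insert singletonI)
  have e: "inj (list_code a b p g)"
    by (rule inj_list_code[OF p assms ab])
  define ls where "ls S = (SOME l. set l = S)" for S :: "'a set"
  have "set (ls S) = S" if "finite S" for S
    unfolding ls_def by (rule someI_ex) (use that finite_list in blast)
  then have "inj_on ls {S. finite S}"
    by (metis inj_on_def mem_Collect_eq)
  then have "inj_on (list_code a b p g \<circ> ls) {S. finite S}"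
    using e by (meson comp_inj_on inj_on_subset top_greatest)
  then show thesis by (rule that)
qed

text \<open>Each member of the uncountable set conflicts with countably many others, and so do all members chosen
before a countable stage together; a next member is therefore always available.\<close>

lemma omega1_chain:
  assumes unc: "uncountable A"
    and bad: "\<And>x. x \<in> A \<Longrightarrow> countable {y \<in> A. \<not> R x y}"
  shows "\<exists>X :: omega1 \<Rightarrow> 'a. range X \<subseteq> A \<and> (\<forall>\<eta> \<xi>. \<eta> < \<xi> \<longrightarrow> R (X \<eta>) (X \<xi>))"
proof -
  have "\<exists>X. \<forall>\<xi> :: omega1. X \<xi> \<in> A \<and> (\<forall>\<eta><\<xi>. R (X \<eta>) (X \<xi>))"
  proof (rule dependent_wellorder_choice)
    fix f and \<xi> :: omega1
    assume *: "\<And>\<eta>. \<eta> < \<xi> \<Longrightarrow> f \<eta> \<in> A \<and> (\<forall>\<zeta><\<eta>. R (f \<zeta>) (f \<eta>))"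
    have "countable (\<Union>\<eta>\<in>{..<\<xi>}. {y \<in> A. \<not> R (f \<eta>) y})"
      using * by (intro countable_UN countable_lessThan_omega1 bad) auto
    then have "\<not> A \<subseteq> (\<Union>\<eta>\<in>{..<\<xi>}. {y \<in> A. \<not> R (f \<eta>) y})"
      using unc countable_subset by blast
    then show "\<exists>x. x \<in> A \<and> (\<forall>\<eta><\<xi>. R (f \<eta>) x)" by auto
  qed auto
  then show ?thesis by blast
qed

text \<open>With strictly increasing levels, cofinality in \<open>\<alpha>\<close> means that the sets eventually lie above every
\<open>\<beta> < \<alpha>\<close>.\<close>

definition climbs :: "('a \<Rightarrow> omega1) \<Rightarrow> (nat \<Rightarrow> 'a set) \<Rightarrow> omega1 \<Rightarrow> bool" where
  "climbs lev T \<alpha> \<longleftrightarrow>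
     (\<forall>n. finite (T n) \<and> T n \<noteq> {} \<and> (\<forall>e\<in>T n. lev e < \<alpha>)) \<and>
     (\<forall>m n. m < n \<longrightarrow> (\<forall>d\<in>T m. \<forall>e\<in>T n. lev d < lev e)) \<and>
     (\<forall>\<beta><\<alpha>. \<exists>n. \<forall>e\<in>T n. \<beta> < lev e)"

lemma cofinal_sequence:
  assumes F: "F \<subseteq> {..<\<alpha>}" and cofinal: "\<And>\<beta>. \<beta> < \<alpha> \<Longrightarrow> \<exists>\<gamma>\<in>F. \<beta> < \<gamma>" and "\<beta>\<^sub>0 < (\<alpha> :: omega1)"
  shows "\<exists>c :: nat \<Rightarrow> omega1. range c \<subseteq> F \<and> strict_mono c \<and> (\<forall>\<beta><\<alpha>. \<exists>n. \<beta> < c n)"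
proof -
  have ne: "{..<\<alpha>} \<noteq> {}" using assms(3) by auto
  define g where "g = from_nat_into {..<\<alpha>}"
  have g: "range g = {..<\<alpha>}"
    unfolding g_def by (rule range_from_nat_into[OF ne countable_lessThan_omega1])
  have "\<exists>c. \<forall>n. c n \<in> F \<and> c n < c (Suc n) \<and> g n < c (Suc n)"
  proof (rule dependent_nat_choice[where P = "\<lambda>_ x. x \<in> F" and Q = "\<lambda>n x y. x < y \<and> g n < y", simplified conj_assoc])
    show "\<exists>x. x \<in> F" using cofinal[OF assms(3)] by blast
  next
    fix x n assume "x \<in> F"
    then have "max x (g n) < \<alpha>" using F g by (auto simp: max_def)
    then show "\<exists>y. y \<in> F \<and> x < y \<and> g n < y" using cofinal by (metis max_less_iff_conj)
  qed
  then obtain c where c: "\<And>n. c n \<in> F" "\<And>n. c n < c (Suc n)" "\<And>n. g n < c (Suc n)" by blast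
  have "range c \<subseteq> F" "strict_mono c"
    using c by (auto simp: strict_mono_Suc_iff)
  moreover have "\<exists>n. \<beta> < c n" if "\<beta> < \<alpha>" for \<beta>
    using c(3) g that by (metis lessThan_iff rangeE)
  ultimately show ?thesis by blast
qed

text \<open>In the thinned family all levels and the code of a set lie below all levels and the code of any later set.
A guess \<open>F \<alpha>\<close> of codes is cofinal in \<open>\<alpha>\<close>, so the levels of the sets that it codes, being caught between
successive codes, climb to \<open>\<alpha>\<close> as well.
The sequence assigned to \<open>\<alpha>\<close> is any climbing one with codes in \<open>F \<alpha>\<close>; it need not be the one found
inside the family, but injectivity of the code puts it into the family.\<close>

lemma clubsuit_guesses_sequences:
  fixes g lev :: "'a \<Rightarrow> omega1"
  assumes "clubsuit" and "inj g" and lev: "\<And>\<beta>. countable {e. lev e \<le> \<beta>}"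
  shows "\<exists>T :: omega1 \<Rightarrow> nat \<Rightarrow> 'a set. \<forall>Z.
    uncountable Z \<and> (\<forall>S\<in>Z. finite S) \<and> {} \<notin> Z \<and> pairwise disjnt Z \<longrightarrow>
      (\<exists>\<alpha>. climbs lev (T \<alpha>) \<alpha> \<and> range (T \<alpha>) \<subseteq> Z)"
proof -
  obtain F :: "omega1 \<Rightarrow> omega1 set" where
    F: "\<And>\<alpha>. is_limit \<alpha> \<Longrightarrow> F \<alpha> \<subseteq> {..<\<alpha>} \<and> (LEAST \<beta>. \<forall>\<gamma>\<in>F \<alpha>. \<gamma> \<le> \<beta>) = \<alpha>"
    and guess: "\<And>A. uncountable A \<Longrightarrow> \<exists>\<alpha>. is_limit \<alpha> \<and> F \<alpha> \<subseteq> A"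
    using assms(1) unfolding clubsuit_def by metis
  obtain code :: "'a set \<Rightarrow> omega1" where code: "inj_on code {S. finite S}"
    using finite_set_code[OF \<open>inj g\<close>] by blast
  define ok where "ok \<alpha> S \<longleftrightarrow> climbs lev S \<alpha> \<and> (\<forall>n. code (S n) \<in> F \<alpha>)" for \<alpha> S
  define T where "T \<alpha> = (SOME S. ok \<alpha> S)" for \<alpha>
  show ?thesis
  proof (rule exI[of _ T], intro allI impI)
    fix Z :: "'a set set"
    assume Z: "uncountable Z \<and> (\<forall>S\<in>Z. finite S) \<and> {} \<notin> Z \<and> pairwise disjnt Z"
    then have unc: "uncountable Z" and fin: "\<And>S. S \<in> Z \<Longrightarrow> finite S"
      and ne: "{} \<notin> Z" and disj: "pairwise disjnt Z"
      by auto
    define ords where "ords S = insert (code S) (lev ` S)" for S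
    define R where "R S S' \<longleftrightarrow> (\<forall>\<beta>\<in>ords S. \<forall>\<gamma>\<in>ords S'. \<beta> < \<gamma>)" for S S'
    have fin_ords: "finite (ords S)" if "S \<in> Z" for S using fin[OF that] by (simp add: ords_def)
    have bound: "countable {S \<in> Z. \<exists>\<gamma>\<in>ords S. \<gamma> \<le> \<beta>}" for \<beta>
    proof -
      have "countable {S \<in> Z. code S \<le> \<beta>}"
      proof (rule countable_image_inj_on[where f = code])
        have "{..\<beta>} = insert \<beta> {..<\<beta>}" by auto
        then have "countable {..\<beta>}" using countable_lessThan_omega1 by simp
        then show "countable (code ` {S \<in> Z. code S \<le> \<beta>})"
          by (rule countable_subset[rotated]) auto
        show "inj_on code {S \<in> Z. code S \<le> \<beta>}"
          using code by (rule inj_on_subset) (use fin in auto)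
      qed
      moreover have "countable {S \<in> Z. \<exists>e\<in>S. lev e \<le> \<beta>}"
      proof -
        \<comment> \<open>By disjointness a set is determined by any one of its members of level at most \<open>\<beta>\<close>.\<close>
        define h where "h S = (SOME e. e \<in> S \<and> lev e \<le> \<beta>)" for S
        have h: "h S \<in> S \<and> lev (h S) \<le> \<beta>" if "\<exists>e\<in>S. lev e \<le> \<beta>" for S
          unfolding h_def by (rule someI_ex) (use that in blast)
        show ?thesis
        proof (rule countable_image_inj_on[where f = h])
          show "countable (h ` {S \<in> Z. \<exists>e\<in>S. lev e \<le> \<beta>})"
            by (rule countable_subset[OF _ lev[of \<beta>]]) (use h in auto)
          show "inj_on h {S \<in> Z. \<exists>e\<in>S. lev e \<le> \<beta>}"
          proof (rule inj_onI)
            fix S S'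
            assume "S \<in> {S \<in> Z. \<exists>e\<in>S. lev e \<le> \<beta>}" "S' \<in> {S \<in> Z. \<exists>e\<in>S. lev e \<le> \<beta>}" "h S = h S'"
            then have "S \<in> Z" "S' \<in> Z" "h S \<in> S \<inter> S'" using h[of S] h[of S'] by auto
            then show "S = S'" using disj by (auto simp: pairwise_def disjnt_def)
          qed
        qed
      qed
      ultimately have "countable ({S \<in> Z. code S \<le> \<beta>} \<union> {S \<in> Z. \<exists>e\<in>S. lev e \<le> \<beta>})" by simp
      then show ?thesis
        by (rule countable_subset[rotated]) (auto simp: ords_def)
    qed
    have bad: "countable {S' \<in> Z. \<not> R S S'}" if "S \<in> Z" for S
    proof -
      have "{S' \<in> Z. \<not> R S S'} = (\<Union>\<beta>\<in>ords S. {S' \<in> Z. \<exists>\<gamma>\<in>ords S'. \<gamma> \<le> \<beta>})"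
        by (auto simp: R_def not_less)
      then show ?thesis using bound fin_ords[OF that] by (simp add: countable_finite)
    qed
    have "\<exists>X :: omega1 \<Rightarrow> 'a set. range X \<subseteq> Z \<and> (\<forall>\<eta> \<xi>. \<eta> < \<xi> \<longrightarrow> R (X \<eta>) (X \<xi>))"
      by (rule omega1_chain[OF unc bad])
    then obtain X :: "omega1 \<Rightarrow> 'a set" where
      X: "range X \<subseteq> Z" "\<And>\<eta> \<xi>. \<eta> < \<xi> \<Longrightarrow> R (X \<eta>) (X \<xi>)"
      by blast
    have lt: "code (X \<eta>) < code (X \<xi>)" "e \<in> X \<xi> \<Longrightarrow> code (X \<eta>) < lev e"
      "d \<in> X \<eta> \<Longrightarrow> lev d < code (X \<xi>)" "d \<in> X \<eta> \<Longrightarrow> e \<in> X \<xi> \<Longrightarrow> lev d < lev e"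
      if "\<eta> < \<xi>" for \<eta> \<xi> d e
      using X(2)[OF that] by (auto simp: R_def ords_def)
    have "inj (\<lambda>\<xi>. code (X \<xi>))"
      by (rule linorder_injI) (simp add: lt(1) less_imp_neq)
    then have "uncountable (range (\<lambda>\<xi>. code (X \<xi>)))"
      using uncountable_UNIV_omega1 countable_image_inj_on[of "\<lambda>\<xi>. code (X \<xi>)" UNIV] by auto
    from guess[OF this] obtain \<alpha> where lim: "is_limit \<alpha>" and Fsub: "F \<alpha> \<subseteq> range (\<lambda>\<xi>. code (X \<xi>))"
      by blast
    have Fa: "F \<alpha> \<subseteq> {..<\<alpha>}" using F[OF lim] by blast
    have cofinal: "\<exists>\<gamma>\<in>F \<alpha>. \<beta> < \<gamma>" if "\<beta> < \<alpha>" for \<beta>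
    proof (rule ccontr)
      assume "\<not> ?thesis"
      then have "(LEAST \<beta>. \<forall>\<gamma>\<in>F \<alpha>. \<gamma> \<le> \<beta>) \<le> \<beta>" by (intro Least_le) (auto simp: not_less)
      then show False using F[OF lim] that by auto
    qed
    obtain \<beta>\<^sub>0 where "\<beta>\<^sub>0 < \<alpha>" using lim by (auto simp: is_limit_def)
    from Fa cofinal this have "\<exists>c :: nat \<Rightarrow> omega1. range c \<subseteq> F \<alpha> \<and> strict_mono c \<and> (\<forall>\<beta><\<alpha>. \<exists>n. \<beta> < c n)"
      by (rule cofinal_sequence)
    then obtain c :: "nat \<Rightarrow> omega1" where
      c: "range c \<subseteq> F \<alpha>" "strict_mono c" "\<And>\<beta>. \<beta> < \<alpha> \<Longrightarrow> \<exists>n. \<beta> < c n"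
      by blast
    obtain \<xi> where \<xi>: "\<And>n. c n = code (X (\<xi> n))"
    proof -
      have "\<exists>\<xi>. c n = code (X \<xi>)" for n using c(1) Fsub by blast
      then show ?thesis using that by metis
    qed
    have mono: "\<xi> m < \<xi> n" if "m < n" for m n
    proof (rule ccontr)
      assume "\<not> \<xi> m < \<xi> n"
      then have "\<xi> n < \<xi> m \<or> \<xi> n = \<xi> m" by auto
      then have "c n \<le> c m" using lt(1)[of "\<xi> n" "\<xi> m"] unfolding \<xi> by auto
      then show False using strict_monoD[OF c(2) that] by simp
    qed
    have "climbs lev (\<lambda>n. X (\<xi> n)) \<alpha>"
      unfolding climbs_def
    proof (intro conjI allI ballI impI)
      show "finite (X (\<xi> n))" "X (\<xi> n) \<noteq> {}" for n using X(1) fin ne by blast+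
      show "lev e < \<alpha>" if "e \<in> X (\<xi> n)" for e n
      proof -
        have "lev e < c (Suc n)" unfolding \<xi> by (rule lt(3)[OF mono[OF lessI] that])
        also have "\<dots> < \<alpha>" using c(1) Fa by auto
        finally show ?thesis .
      qed
      show "lev d < lev e" if "m < n" "d \<in> X (\<xi> m)" "e \<in> X (\<xi> n)" for m n d e
        by (rule lt(4)[OF mono[OF that(1)] that(2,3)])
      show "\<exists>n. \<forall>e\<in>X (\<xi> n). \<beta> < lev e" if "\<beta> < \<alpha>" for \<beta>
      proof -
        obtain n where "\<beta> < c n" using c(3) \<open>\<beta> < \<alpha>\<close> by blast
        then have "\<beta> < lev e" if "e \<in> X (\<xi> (Suc n))" for e
          using lt(2)[OF mono[OF lessI] that] unfolding \<xi> by (rule less_trans)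
        then show ?thesis by blast
      qed
    qed
    moreover have "code (X (\<xi> n)) \<in> F \<alpha>" for n
      using c(1) unfolding \<xi>[symmetric] by blast
    ultimately have "ok \<alpha> (\<lambda>n. X (\<xi> n))" by (simp add: ok_def)
    then have "ok \<alpha> (T \<alpha>)" unfolding T_def by (rule someI[of "ok \<alpha>"])
    moreover have "T \<alpha> n \<in> Z" if "ok \<alpha> (T \<alpha>)" for n
    proof -
      have "code (T \<alpha> n) \<in> F \<alpha>" using that by (simp add: ok_def)
      then obtain \<eta> where "code (T \<alpha> n) = code (X \<eta>)" using Fsub by blast
      moreover have "finite (T \<alpha> n)" using that by (auto simp: ok_def climbs_def)
      moreover have "X \<eta> \<in> Z" using X(1) by blast
      ultimately show ?thesis using code fin by (metis inj_onD mem_Collect_eq)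
    qed
    ultimately show "\<exists>\<alpha>. climbs lev (T \<alpha>) \<alpha> \<and> range (T \<alpha>) \<subseteq> Z"
      by (auto simp: ok_def)
  qed
qed

section \<open>Building the levels\<close>

type_synonym point = "omega1 \<times> nat"

datatype level = Level (width: nat) (base: "nat \<Rightarrow> nat \<Rightarrow> point set") (ranks: "nat \<Rightarrow> nat")

definition points :: "(omega1 \<Rightarrow> level) \<Rightarrow> point set" where
  "points f = {p. snd p \<le> width (f (fst p))}"

definition below :: "(omega1 \<Rightarrow> level) \<Rightarrow> omega1 \<Rightarrow> point set" where
  "below f \<alpha> = {p \<in> points f. fst p < \<alpha>}"

definition nbhd :: "(omega1 \<Rightarrow> level) \<Rightarrow> point \<Rightarrow> nat \<Rightarrow> point set" where
  "nbhd f p n = base (f (fst p)) (snd p) n"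

definition point_rank :: "(omega1 \<Rightarrow> level) \<Rightarrow> point \<Rightarrow> nat" where
  "point_rank f p = ranks (f (fst p)) (snd p)"

text \<open>The instructions that a level obeys: an element \<open>(p, j)\<close> stands for the point \<open>p\<close> with label \<open>j\<close>.\<close>

definition catchable :: "(omega1 \<Rightarrow> level) \<Rightarrow> (nat \<Rightarrow> (point \<times> nat) set) \<Rightarrow> omega1 \<Rightarrow> bool" where
  "catchable f t \<alpha> \<longleftrightarrow>
     climbs (fst \<circ> fst) t \<alpha> \<and>
     (\<forall>n p i j. (p, i) \<in> t n \<longrightarrow> (p, j) \<in> t n \<longrightarrow> i = j) \<and>
     (\<forall>n p j. (p, j) \<in> t n \<longrightarrow> p \<in> below f \<alpha>) \<and>
     (\<exists>k. \<forall>n p j. (p, j) \<in> t n \<longrightarrow> j \<le> k) \<and>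
     (\<exists>r. \<forall>n p j. (p, j) \<in> t n \<longrightarrow> point_rank f p \<le> r)"

text \<open>In order: basic neighbourhoods decrease; ranks drop inside them; the points of a level are separated; the
level map is continuous; consecutive basic neighbourhoods differ by finitely many basic neighbourhoods of
lower points, which yields both openness and compactness by induction on the level; and a catchable
instruction is obeyed.  Only the levels up to \<open>\<alpha>\<close> are mentioned, so that the condition can drive a recursion.\<close>

definition level_ok :: "(omega1 \<Rightarrow> level) \<Rightarrow> (nat \<Rightarrow> (point \<times> nat) set) \<Rightarrow> omega1 \<Rightarrow> bool" where
  "level_ok f t \<alpha> \<longleftrightarrow>
     (\<forall>j\<le>width (f \<alpha>).
       (\<forall>n. (\<alpha>, j) \<in> nbhd f (\<alpha>, j) n \<and> nbhd f (\<alpha>, j) (Suc n) \<subseteq> nbhd f (\<alpha>, j) n) \<and>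
       (\<forall>y\<in>nbhd f (\<alpha>, j) 0 - {(\<alpha>, j)}. y \<in> below f \<alpha> \<and> point_rank f y < point_rank f (\<alpha>, j)) \<and>
       (\<forall>i\<le>width (f \<alpha>). i \<noteq> j \<longrightarrow> nbhd f (\<alpha>, i) 0 \<inter> nbhd f (\<alpha>, j) 0 = {}) \<and>
       (\<forall>\<beta><\<alpha>. \<exists>n. \<forall>y\<in>nbhd f (\<alpha>, j) n. \<beta> < fst y) \<and>
       (\<forall>n. \<exists>Q. finite Q \<and> Q \<subseteq> below f \<alpha> \<times> UNIV \<and>
          nbhd f (\<alpha>, j) n = nbhd f (\<alpha>, j) (Suc n) \<union> (\<Union>(q, i)\<in>Q. nbhd f q i))) \<and>
     (catchable f t \<alpha> \<longrightarrow>
       (\<forall>n p j. (p, j) \<in> t n \<longrightarrow>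
          (if j = 0 then \<forall>i\<le>width (f \<alpha>). p \<notin> nbhd f (\<alpha>, i) 0
           else j \<le> width (f \<alpha>) \<and> p \<in> nbhd f (\<alpha>, j) n)))"

lemma level_ok_local:
  assumes agree: "\<And>\<beta>. \<beta> \<le> \<alpha> \<Longrightarrow> f \<beta> = g \<beta>"
  shows "level_ok f t \<alpha> \<longleftrightarrow> level_ok g t \<alpha>"
proof -
  have [simp]: "f \<alpha> = g \<alpha>" "nbhd f (\<alpha>, j) = nbhd g (\<alpha>, j)" "point_rank f (\<alpha>, j) = point_rank g (\<alpha>, j)" for j
    using agree[of \<alpha>] by (simp_all add: nbhd_def fun_eq_iff point_rank_def)
  have [simp]: "below f \<alpha> = below g \<alpha>"
    using agree by (auto simp: below_def points_def)
  have eq: "nbhd f q = nbhd g q" "point_rank f q = point_rank g q" if "q \<in> below g \<alpha>" for q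
    using agree[of "fst q"] that by (auto simp: nbhd_def fun_eq_iff point_rank_def below_def)
  have "(\<Union>(q, i)\<in>Q. nbhd f q i) = (\<Union>(q, i)\<in>Q. nbhd g q i)" if "Q \<subseteq> below g \<alpha> \<times> UNIV" for Q
    using that eq by (intro SUP_cong) auto
  moreover have "catchable f t \<alpha> \<longleftrightarrow> catchable g t \<alpha>"
    using eq(2) unfolding catchable_def by (simp cong: conj_cong)
  ultimately show ?thesis
    unfolding level_ok_def using eq(2) by (simp cong: conj_cong)
qed

lemma level_okD:
  assumes "level_ok f t (fst p)" "p \<in> points f"
  shows "p \<in> nbhd f p n" "nbhd f p (Suc n) \<subseteq> nbhd f p n"
    "\<lbrakk>y \<in> nbhd f p 0; y \<noteq> p\<rbrakk> \<Longrightarrow> y \<in> below f (fst p)"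
    "\<lbrakk>y \<in> nbhd f p 0; y \<noteq> p\<rbrakk> \<Longrightarrow> point_rank f y < point_rank f p"
    "\<lbrakk>q \<in> points f; fst q = fst p; q \<noteq> p\<rbrakk> \<Longrightarrow> nbhd f q 0 \<inter> nbhd f p 0 = {}"
    "\<beta> < fst p \<Longrightarrow> \<exists>n. \<forall>y\<in>nbhd f p n. \<beta> < fst y"
    "\<exists>Q. finite Q \<and> Q \<subseteq> below f (fst p) \<times> UNIV \<and>
      nbhd f p n = nbhd f p (Suc n) \<union> (\<Union>(q, i)\<in>Q. nbhd f q i)"
proof -
  obtain \<alpha> j where p: "p = (\<alpha>, j)" by (cases p)
  have j: "j \<le> width (f \<alpha>)" using assms(2) by (simp add: p points_def)
  note L = assms(1)[unfolded level_ok_def p fst_conv, THEN conjunct1, rule_format, OF j]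
  show "p \<in> nbhd f p n" "nbhd f p (Suc n) \<subseteq> nbhd f p n"
    using L unfolding p by blast+
  show "y \<in> below f (fst p)" "point_rank f y < point_rank f p" if "y \<in> nbhd f p 0" "y \<noteq> p"
    using L that unfolding p by auto
  show "\<exists>n. \<forall>y\<in>nbhd f p n. \<beta> < fst y" if "\<beta> < fst p"
    using L that unfolding p by auto
  show "\<exists>Q. finite Q \<and> Q \<subseteq> below f (fst p) \<times> UNIV \<and>
      nbhd f p n = nbhd f p (Suc n) \<union> (\<Union>(q, i)\<in>Q. nbhd f q i)"
    using L unfolding p by simp
  show "nbhd f q 0 \<inter> nbhd f p 0 = {}" if "q \<in> points f" "fst q = fst p" "q \<noteq> p"
    using L that unfolding p by (cases q) (auto simp: points_def)
qed

lemma nbhd_antimono: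
  assumes "level_ok f t (fst p)" "p \<in> points f" "m \<le> n"
  shows "nbhd f p n \<subseteq> nbhd f p m"
  using lift_Suc_antimono_le[of "nbhd f p"] level_okD(2)[OF assms(1,2)] assms(3) by blast

lemma nbhd_below:
  assumes ok: "level_ok f t (fst p)" "p \<in> points f" and y: "y \<in> nbhd f p n"
  shows "y \<in> points f" "fst y \<le> fst p" "point_rank f y \<le> point_rank f p"
proof -
  have y0: "y \<in> nbhd f p 0" using nbhd_antimono[OF ok, of 0 n] y by blast
  show "y \<in> points f" "fst y \<le> fst p" "point_rank f y \<le> point_rank f p"
    using level_okD(3,4)[OF ok y0] ok by (cases "y = p"; auto simp: below_def)+
qed

lemma eventually_nbhd_above:
  assumes ok: "level_ok f t (fst p)" "p \<in> points f" and "\<beta> < fst p"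
  shows "\<forall>\<^sub>F n in sequentially. \<forall>y\<in>nbhd f p n. \<beta> < fst y"
  using level_okD(6)[OF assms] nbhd_antimono[OF ok] unfolding eventually_sequentially by (meson subsetD)

lemma eventually_nbhd_disjoint:
  assumes ok: "level_ok f t (fst p)" "p \<in> points f" "level_ok f u (fst q)" "q \<in> points f" and "p \<noteq> q"
  shows "\<forall>\<^sub>F n in sequentially. nbhd f p n \<inter> nbhd f q n = {}"
proof (cases "fst p" "fst q" rule: linorder_cases)
  case less
  show ?thesis
    using eventually_nbhd_above[OF ok(3,4) less]
    by eventually_elim (use nbhd_below(2)[OF ok(1,2)] in fastforce)
next
  case equal
  then have "nbhd f p 0 \<inter> nbhd f q 0 = {}" using level_okD(5)[OF ok(3,4,2)] \<open>p \<noteq> q\<close> by blast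
  then have "nbhd f p n \<inter> nbhd f q n = {}" for n
    using nbhd_antimono[OF ok(1,2), of 0 n] nbhd_antimono[OF ok(3,4), of 0 n] by blast
  then show ?thesis by simp
next
  case greater
  show ?thesis
    using eventually_nbhd_above[OF ok(1,2) greater]
    by eventually_elim (use nbhd_below(2)[OF ok(3,4)] in fastforce)
qed

lemma fun_upd_below:
  assumes "fst q < \<alpha>"
  shows "nbhd (f(\<alpha> := d)) q = nbhd f q" "point_rank (f(\<alpha> := d)) q = point_rank f q"
  using assms by (auto simp: nbhd_def fun_eq_iff point_rank_def)

lemma below_fun_upd [simp]: "below (f(\<alpha> := d)) \<alpha> = below f \<alpha>"
  by (auto simp: below_def points_def)

lemma catchable_fun_upd [simp]: "catchable (f(\<alpha> := d)) t \<alpha> \<longleftrightarrow> catchable f t \<alpha>"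
proof -
  have eq: "point_rank (f(\<alpha> := d)) q = point_rank f q" if "q \<in> below f \<alpha>" for q
    using that fun_upd_below(2) by (simp add: below_def)
  show ?thesis
    using eq unfolding catchable_def by (simp cong: conj_cong)
qed

text \<open>If the instruction \<open>t\<close> is catchable, the point \<open>(\<alpha>, j)\<close> with \<open>j \<ge> 1\<close> gets as its \<open>n\<close>-th basic neighbourhood the union, over
\<open>m \<ge> n\<close>, of the \<open>h m\<close>-th neighbourhoods of the points of label \<open>j\<close> in \<open>t m\<close>.  The number \<open>h m\<close> is so large that
the neighbourhoods of distinct points of \<open>t m\<close> are disjoint and lie above all levels in \<open>t l\<close> for \<open>l < m\<close>;
then all neighbourhoods that are used are pairwise disjoint.  Otherwise the level is one isolated
point.  The point \<open>(\<alpha>, 0)\<close> is isolated in either case.\<close>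

lemma level_extension:
  assumes ok: "\<And>\<beta>. \<beta> < \<alpha> \<Longrightarrow> level_ok f (T \<beta>) \<beta>"
  shows "\<exists>d. level_ok (f(\<alpha> := d)) t \<alpha>"
proof (cases "catchable f t \<alpha>")
  case False
  define g where "g = f(\<alpha> := Level 0 (\<lambda>j n. {(\<alpha>, j)}) (\<lambda>j. 0))"
  have nb: "nbhd g (\<alpha>, j) n = {(\<alpha>, j)}" for j n by (simp add: nbhd_def g_def)
  have "level_ok g t \<alpha>"
    unfolding level_ok_def nb using False by (auto simp: g_def intro!: exI[of _ "{}"])
  then show ?thesis unfolding g_def by blast
next
  case True
  then have climb: "climbs (fst \<circ> fst) t \<alpha>"
    and label: "\<And>n p i j. \<lbrakk>(p, i) \<in> t n; (p, j) \<in> t n\<rbrakk> \<Longrightarrow> i = j"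
    and bel: "\<And>n p j. (p, j) \<in> t n \<Longrightarrow> p \<in> below f \<alpha>"
    unfolding catchable_def by blast+
  have fin: "finite (t n)" and ne: "t n \<noteq> {}" for n
    using climb by (simp_all add: climbs_def)
  have lev: "fst p < \<alpha>" if "(p, j) \<in> t n" for p j n
    using bel[OF that] by (simp add: below_def)
  have inc: "fst p < fst q" if "m < n" "(p, i) \<in> t m" "(q, j) \<in> t n" for m n p i q j
    using climb that unfolding climbs_def by fastforce
  have cof: "\<exists>n. \<forall>p j. (p, j) \<in> t n \<longrightarrow> \<beta> < fst p" if "\<beta> < \<alpha>" for \<beta>
    using climb that unfolding climbs_def by fastforce
  have "\<exists>k. \<forall>n p j. (p, j) \<in> t n \<longrightarrow> j \<le> k"
    using True by (simp add: catchable_def)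
  then obtain k where k: "\<And>n p j. (p, j) \<in> t n \<Longrightarrow> j \<le> k" by blast
  have "\<exists>r. \<forall>n p j. (p, j) \<in> t n \<longrightarrow> point_rank f p \<le> r"
    using True by (simp add: catchable_def)
  then obtain r where r: "\<And>n p j. (p, j) \<in> t n \<Longrightarrow> point_rank f p \<le> r" by blast
  have pok: "level_ok f (T (fst p)) (fst p)" "p \<in> points f" if "p \<in> below f \<alpha>" for p
    using ok that by (auto simp: below_def)
  have tok: "level_ok f (T (fst p)) (fst p)" "p \<in> points f" if "(p, j) \<in> t n" for p j n
    using pok[OF bel[OF that]] by auto
  define good where "good m h \<longleftrightarrow>
      (\<forall>e\<in>t m. \<forall>d\<in>t m. fst e \<noteq> fst d \<longrightarrow> nbhd f (fst e) h \<inter> nbhd f (fst d) h = {}) \<and>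
      (\<forall>l\<in>{..<m}. \<forall>d\<in>t l. \<forall>e\<in>t m. \<forall>y\<in>nbhd f (fst e) h. fst (fst d) < fst y)" for m h
  have "\<exists>h. good m h" for m
    unfolding good_def
  proof (rule eventually_happens'[OF sequentially_bot], intro eventually_conj eventually_ball_finite ballI fin finite_lessThan)
    fix e d assume ed: "e \<in> t m" "d \<in> t m"
    then show "\<forall>\<^sub>F h in sequentially. fst e \<noteq> fst d \<longrightarrow> nbhd f (fst e) h \<inter> nbhd f (fst d) h = {}"
      using eventually_nbhd_disjoint[OF tok[of "fst e" "snd e"] tok[of "fst d" "snd d"]]
      by (cases "fst e = fst d") auto
  next
    fix l d e assume "l \<in> {..<m}" "d \<in> t l" "e \<in> t m"
    then show "\<forall>\<^sub>F h in sequentially. \<forall>y\<in>nbhd f (fst e) h. fst (fst d) < fst y"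
      using eventually_nbhd_above[OF tok[of "fst e" "snd e"]] inc[of l m "fst d" "snd d" "fst e" "snd e"] by auto
  qed
  then obtain h where h: "\<And>m. good m (h m)" by metis
  have h_disj: "nbhd f p (h m) \<inter> nbhd f q (h m) = {}"
    if "(p, i) \<in> t m" "(q, j) \<in> t m" "p \<noteq> q" for m p i q j
    using h[of m, unfolded good_def, THEN conjunct1] that by force
  have h_above: "fst p < fst y"
    if "l < m" "(p, i) \<in> t l" "(q, j) \<in> t m" "y \<in> nbhd f q (h m)" for l m p i q j y
    using h[of m, unfolded good_def, THEN conjunct2] that by force
  \<comment> \<open>Levels in the neighbourhood of \<open>p\<close> do not exceed that of \<open>p\<close>, which lies below the neighbourhoods
    used at any later \<open>n\<close>.\<close>
  have uniq_le: "\<not> m < n" if "(p, i) \<in> t m" "(q, j) \<in> t n" "y \<in> nbhd f p (h m)" "y \<in> nbhd f q (h n)"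
    for p q m n i j y
    using h_above[of m n p i q j y] nbhd_below(2)[OF tok[OF that(1)] that(3)] that by auto
  have uniq: "m = n \<and> p = q \<and> i = j"
    if "(p, i) \<in> t m" "(q, j) \<in> t n" "y \<in> nbhd f p (h m)" "y \<in> nbhd f q (h n)"
    for p q m n i j y
  proof -
    have "m = n" using uniq_le[of p i m q j n y] uniq_le[of q j n p i m y] that by auto
    moreover from this have "p = q" using h_disj[of p i m q j] that by auto
    ultimately show ?thesis using label[of p i m j] that by auto
  qed
  define c where "c j n = insert (\<alpha>, j) (if j = 0 then {} else \<Union>m\<in>{n..}. \<Union>q\<in>{q. (q, j) \<in> t m}. nbhd f q (h m))"
    for j n
  define g where "g = f(\<alpha> := Level k c (\<lambda>_. Suc r))"
  have nb: "nbhd g (\<alpha>, j) n = c j n" and w: "width (g \<alpha>) = k" and rk: "point_rank g (\<alpha>, j) = Suc r" for j n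
    by (simp_all add: nbhd_def g_def point_rank_def)
  have gb: "nbhd g q = nbhd f q" "point_rank g q = point_rank f q" if "q \<in> below f \<alpha>" for q
    using that fun_upd_below unfolding g_def by (auto simp: below_def)
  have bg: "below g \<alpha> = below f \<alpha>" by (simp add: g_def)
  have c_iff: "y \<in> c j n \<longleftrightarrow> y = (\<alpha>, j) \<or> j \<noteq> 0 \<and> (\<exists>m\<ge>n. \<exists>q. (q, j) \<in> t m \<and> y \<in> nbhd f q (h m))" for y j n
    by (auto simp: c_def)
  have y_below: "y \<in> below f \<alpha> \<and> point_rank f y \<le> r" if "(q, j) \<in> t m" "y \<in> nbhd f q (h m)" for q j m y
    using nbhd_below[OF tok[OF that(1)] that(2)] lev[OF that(1)] r[OF that(1)] by (auto simp: below_def)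
  have "level_ok g t \<alpha>"
    unfolding level_ok_def nb w rk bg
  proof (intro conjI allI impI ballI)
    fix j n assume "j \<le> k"
    show "(\<alpha>, j) \<in> c j n" by (simp add: c_iff)
    show "c j (Suc n) \<subseteq> c j n" unfolding subset_iff c_iff using Suc_leD by blast
  next
    fix j y assume "y \<in> c j 0 - {(\<alpha>, j)}"
    then obtain m q where "(q, j) \<in> t m" "y \<in> nbhd f q (h m)" by (auto simp: c_iff)
    then show "y \<in> below f \<alpha>" "point_rank g y < Suc r"
      using y_below[of q j m y] gb(2)[of y] by auto
  next
    fix i j :: nat assume "i \<noteq> j"
    have "(\<alpha>, l) \<notin> nbhd f q (h m)" if "(q, l') \<in> t m" for l l' q m
      using y_below[OF that, of "(\<alpha>, l)"] by (auto simp: below_def)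
    then have "y \<notin> c j 0" if "y \<in> c i 0" for y
      using that uniq[of _ i _ _ j _ y] \<open>i \<noteq> j\<close> by (auto simp: c_iff)
    then show "c i 0 \<inter> c j 0 = {}" by blast
  next
    fix j \<beta> assume "\<beta> < \<alpha>"
    then obtain n where n: "\<And>p j. (p, j) \<in> t n \<Longrightarrow> \<beta> < fst p" using cof by blast
    show "\<exists>n. \<forall>y\<in>c j n. \<beta> < fst y"
    proof -
      obtain p i where p: "(p, i) \<in> t n" using ne[of n] by (metis ex_in_conv surj_pair)
      \<comment> \<open>From \<open>Suc n\<close> on, the neighbourhoods lie above a level of \<open>t n\<close>; those at \<open>n\<close> itself may reach below \<open>\<beta>\<close>.\<close>
      have "\<beta> < fst y" if "y \<in> c j (Suc n)" for y
      proof (cases "y = (\<alpha>, j)")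
        case True
        then show ?thesis using \<open>\<beta> < \<alpha>\<close> by simp
      next
        case False
        then obtain m q where "n < m" "(q, j) \<in> t m" "y \<in> nbhd f q (h m)"
          using \<open>y \<in> c j (Suc n)\<close> by (auto simp: c_iff Suc_le_eq)
        then have "fst p < fst y" using h_above p by blast
        then show ?thesis using n[OF p] by simp
      qed
      then show ?thesis by blast
    qed
  next
    fix j n
    define Q where "Q = {(q, i). (q, j) \<in> t n \<and> i = h n \<and> j \<noteq> 0}"
    have "Q \<subseteq> (\<lambda>e. (fst e, h n)) ` t n" by (force simp: Q_def)
    then have "finite Q" using fin finite_surj by blast
    moreover have Q: "Q \<subseteq> below f \<alpha> \<times> UNIV" using bel by (auto simp: Q_def)
    moreover have "c j n = c j (Suc n) \<union> (\<Union>(q, i)\<in>Q. nbhd g q i)"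
    proof -
      have "(\<Union>(q, i)\<in>Q. nbhd g q i) = (\<Union>(q, i)\<in>Q. nbhd f q i)"
        using Q gb(1) by (intro SUP_cong) auto
      moreover have "y \<in> (\<Union>(q, i)\<in>Q. nbhd f q i) \<longleftrightarrow>
          j \<noteq> 0 \<and> (\<exists>q. (q, j) \<in> t n \<and> y \<in> nbhd f q (h n))" for y
        by (auto simp: Q_def)
      moreover have "(\<exists>m\<ge>n. R m) \<longleftrightarrow> R n \<or> (\<exists>m\<ge>Suc n. R m)" for R
        by (metis Suc_le_eq le_eq_less_or_eq)
      ultimately show ?thesis by (intro set_eqI) (simp only: Un_iff c_iff, blast)
    qed
    ultimately show "\<exists>Q. finite Q \<and> Q \<subseteq> below f \<alpha> \<times> UNIV \<and> c j n = c j (Suc n) \<union> (\<Union>(q, i)\<in>Q. nbhd g q i)"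
      by blast
  next
    fix n p j assume p: "(p, j) \<in> t n"
    have p_nb: "p \<in> nbhd f p (h n)" using level_okD(1)[OF tok[OF p]] .
    show "if j = 0 then \<forall>i\<le>k. p \<notin> c i 0 else j \<le> k \<and> p \<in> c j n"
    proof (cases "j = 0")
      case True
      have "p \<notin> c i 0" for i
        using uniq[OF p _ p_nb] lev[OF p] True unfolding c_iff by auto
      then show ?thesis using True by simp
    next
      case False
      then have "p \<in> c j n" unfolding c_iff using p p_nb by blast
      then show ?thesis using False k[OF p] by simp
    qed
  qed
  then show ?thesis unfolding g_def by blast
qed

lemma levels_exist: "\<exists>f. \<forall>\<alpha>. level_ok f (T \<alpha>) \<alpha>"
proof -
  have "\<exists>f. \<forall>\<alpha>. level_ok (f(\<alpha> := f \<alpha>)) (T \<alpha>) \<alpha>"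
  proof (rule dependent_wellorder_choice)
    fix d and f g :: "omega1 \<Rightarrow> level" and \<alpha>
    assume "\<And>\<beta>. \<beta> < \<alpha> \<Longrightarrow> f \<beta> = g \<beta>"
    then show "level_ok (f(\<alpha> := d)) (T \<alpha>) \<alpha> = level_ok (g(\<alpha> := d)) (T \<alpha>) \<alpha>"
      by (intro level_ok_local) auto
  next
    fix \<alpha> f assume "\<And>\<beta>. \<beta> < \<alpha> \<Longrightarrow> level_ok (f(\<beta> := f \<beta>)) (T \<beta>) \<beta>"
    then show "\<exists>d. level_ok (f(\<alpha> := d)) (T \<alpha>) \<alpha>"
      by (intro level_extension[where T = T]) simp
  qed
  then show ?thesis by simp
qed

section \<open>The topology\<close>

locale guided_levels =
  fixes T :: "omega1 \<Rightarrow> nat \<Rightarrow> (point \<times> nat) set" and f :: "omega1 \<Rightarrow> level"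
  assumes ok: "level_ok f (T \<alpha>) \<alpha>"
    and guess: "uncountable Z \<and> (\<forall>S\<in>Z. finite S) \<and> {} \<notin> Z \<and> pairwise disjnt Z
      \<Longrightarrow> \<exists>\<alpha>. climbs (fst \<circ> fst) (T \<alpha>) \<alpha> \<and> range (T \<alpha>) \<subseteq> Z"
begin

definition ladder_space :: "point topology" where
  "ladder_space = topology (\<lambda>U. U \<subseteq> points f \<and> (\<forall>p\<in>U. \<exists>n. nbhd f p n \<subseteq> U))"

lemmas self_in_nbhd = level_okD(1)[OF ok]
lemmas antimono = nbhd_antimono[OF ok]

lemma openin_ladder_space: "openin ladder_space U \<longleftrightarrow> U \<subseteq> points f \<and> (\<forall>p\<in>U. \<exists>n. nbhd f p n \<subseteq> U)"
proof -
  have "istopology (\<lambda>U. U \<subseteq> points f \<and> (\<forall>p\<in>U. \<exists>n. nbhd f p n \<subseteq> U))"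
    unfolding istopology_def
  proof (intro conjI allI impI)
    fix U V assume U: "U \<subseteq> points f \<and> (\<forall>p\<in>U. \<exists>n. nbhd f p n \<subseteq> U)"
      and V: "V \<subseteq> points f \<and> (\<forall>p\<in>V. \<exists>n. nbhd f p n \<subseteq> V)"
    show "\<forall>p\<in>U \<inter> V. \<exists>n. nbhd f p n \<subseteq> U \<inter> V"
    proof
      fix p assume p: "p \<in> U \<inter> V"
      then obtain m n where "nbhd f p m \<subseteq> U" "nbhd f p n \<subseteq> V" using U V by blast
      then have "nbhd f p (max m n) \<subseteq> U \<inter> V"
        using antimono[of p m "max m n"] antimono[of p n "max m n"] p U by auto
      then show "\<exists>n. nbhd f p n \<subseteq> U \<inter> V" by blast
    qed
    show "U \<inter> V \<subseteq> points f" using U by blast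
  next
    fix \<K> assume \<K>: "\<forall>K\<in>\<K>. K \<subseteq> points f \<and> (\<forall>p\<in>K. \<exists>n. nbhd f p n \<subseteq> K)"
    show "\<Union>\<K> \<subseteq> points f" using \<K> by blast
    show "\<forall>p\<in>\<Union>\<K>. \<exists>n. nbhd f p n \<subseteq> \<Union>\<K>"
      using \<K> by (meson Union_iff Union_upper order_trans)
  qed
  then show ?thesis by (simp add: ladder_space_def topology_inverse')
qed

lemma nbhd_subset_points: "p \<in> points f \<Longrightarrow> nbhd f p n \<subseteq> points f"
  using nbhd_below(1)[OF ok] by blast

lemma topspace_ladder_space: "topspace ladder_space = points f"
proof
  show "topspace ladder_space \<subseteq> points f" using openin_ladder_space openin_topspace by blast
  have "openin ladder_space (points f)" unfolding openin_ladder_space using nbhd_subset_points by blast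
  then show "points f \<subseteq> topspace ladder_space" by (rule openin_subset)
qed

text \<open>A point \<open>y\<close> other than \<open>p\<close> drops out of the decreasing neighbourhoods of \<open>p\<close> at some step, because their
levels eventually exceed that of \<open>y\<close>.  What is lost at that step is covered by neighbourhoods of lower points.\<close>

lemma openin_nbhd: "p \<in> points f \<Longrightarrow> openin ladder_space (nbhd f p n)"
proof (induction "fst p" arbitrary: p n rule: less_induct)
  case less
  have "\<exists>l. nbhd f y l \<subseteq> nbhd f p n" if y: "y \<in> nbhd f p n" for y
  proof (cases "y = p")
    case False
    have "y \<in> nbhd f p 0" using antimono[OF less.prems, of 0 n] y by blast
    then have "fst y < fst p" using level_okD(3)[OF ok less.prems _ False] by (simp add: below_def)
    then obtain N where N: "\<forall>z\<in>nbhd f p N. fst y < fst z" using level_okD(6)[OF ok less.prems] by blast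
    have "\<exists>m\<ge>n. y \<in> nbhd f p m \<and> y \<notin> nbhd f p (Suc m)"
    proof (rule ccontr)
      assume "\<not> ?thesis"
      then have up: "y \<in> nbhd f p m \<Longrightarrow> n \<le> m \<Longrightarrow> y \<in> nbhd f p (Suc m)" for m by blast
      have "y \<in> nbhd f p m" if "n \<le> m" for m
        using that by (induction rule: dec_induct) (auto intro: y up)
      then have "y \<in> nbhd f p (max n N)" by simp
      then show False using N antimono[OF less.prems, of N "max n N"] by auto
    qed
    then obtain m where m: "m \<ge> n" "y \<in> nbhd f p m" "y \<notin> nbhd f p (Suc m)" by blast
    obtain Q where Q: "Q \<subseteq> below f (fst p) \<times> UNIV"
      "nbhd f p m = nbhd f p (Suc m) \<union> (\<Union>(q, i)\<in>Q. nbhd f q i)"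
      using level_okD(7)[OF ok less.prems, of m] by blast
    then obtain q i where q: "(q, i) \<in> Q" "y \<in> nbhd f q i" using m by blast
    then have "openin ladder_space (nbhd f q i)" using Q(1) by (intro less.hyps) (auto simp: below_def)
    then obtain l where "nbhd f y l \<subseteq> nbhd f q i" using q openin_ladder_space by blast
    also have "\<dots> \<subseteq> nbhd f p m" using q Q(2) by blast
    also have "\<dots> \<subseteq> nbhd f p n" using antimono[OF less.prems m(1)] .
    finally show ?thesis by blast
  qed blast
  then show ?case unfolding openin_ladder_space using nbhd_subset_points[OF less.prems] by blast
qed

text \<open>A member of an open cover that contains \<open>p\<close> swallows some basic neighbourhood of \<open>p\<close>, and the rest is
covered by finitely many basic neighbourhoods of lower points, which are compact by induction.\<close>

lemma compactin_nbhd: "p \<in> points f \<Longrightarrow> compactin ladder_space (nbhd f p n)"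
proof (induction "fst p" arbitrary: p n rule: less_induct)
  case less
  have rest: "\<exists>K. compactin ladder_space K \<and> nbhd f p n = nbhd f p (n + m) \<union> K" for m
  proof (induction m)
    case 0
    show ?case by (intro exI[of _ "{}"]) simp
  next
    case (Suc m)
    then obtain K where K: "compactin ladder_space K" "nbhd f p n = nbhd f p (n + m) \<union> K" by blast
    obtain Q where Q: "finite Q" "Q \<subseteq> below f (fst p) \<times> UNIV"
      "nbhd f p (n + m) = nbhd f p (Suc (n + m)) \<union> (\<Union>(q, i)\<in>Q. nbhd f q i)"
      using level_okD(7)[OF ok less.prems, of "n + m"] by blast
    have "compactin ladder_space (\<Union>(q, i)\<in>Q. nbhd f q i)"
      using Q(1,2) less.hyps by (intro compactin_Union) (auto simp: below_def)
    then have "compactin ladder_space ((\<Union>(q, i)\<in>Q. nbhd f q i) \<union> K)" using K(1) by (rule compactin_Un)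
    then show ?case using K(2) Q(3) by (metis Un_assoc add_Suc_right)
  qed
  show ?case
    unfolding compactin_def
  proof (intro conjI allI impI)
    show "nbhd f p n \<subseteq> topspace ladder_space" using nbhd_subset_points[OF less.prems] by (simp add: topspace_ladder_space)
    fix \<U> assume \<U>: "Ball \<U> (openin ladder_space) \<and> nbhd f p n \<subseteq> \<Union>\<U>"
    have "p \<in> nbhd f p n" by (rule self_in_nbhd[OF less.prems])
    then obtain U where U: "U \<in> \<U>" "p \<in> U" using \<U> by blast
    then have "openin ladder_space U" using \<U> by blast
    then obtain l where l: "nbhd f p l \<subseteq> U" using U(2) unfolding openin_ladder_space by blast
    obtain K where K: "compactin ladder_space K" "nbhd f p n = nbhd f p (n + l) \<union> K" using rest by blast
    have "K \<subseteq> \<Union>\<U>" using K(2) \<U> by blast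
    then obtain \<F> where "finite \<F>" "\<F> \<subseteq> \<U>" "K \<subseteq> \<Union>\<F>"
      using \<U> compactinD[OF K(1), of \<U>] by auto
    moreover have "nbhd f p (n + l) \<subseteq> U" using l antimono[OF less.prems, of l "n + l"] by auto
    ultimately have "finite (insert U \<F>)" "insert U \<F> \<subseteq> \<U>" "nbhd f p n \<subseteq> \<Union>(insert U \<F>)"
      using U K(2) by auto
    then show "\<exists>\<F>. finite \<F> \<and> \<F> \<subseteq> \<U> \<and> nbhd f p n \<subseteq> \<Union>\<F>" by blast
  qed
qed

lemma class_S_ladder_space: "class_S ladder_space"
  unfolding class_S_def
proof (intro conjI exI[of _ fst] allI)
  show "locally_compact_space ladder_space"
    unfolding locally_compact_space_def topspace_ladder_space
  proof
    fix p assume "p \<in> points f"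
    then have "openin ladder_space (nbhd f p 0)" "compactin ladder_space (nbhd f p 0)" "p \<in> nbhd f p 0"
      by (rule openin_nbhd, rule compactin_nbhd, rule self_in_nbhd)
    then show "\<exists>U K. openin ladder_space U \<and> compactin ladder_space K \<and> p \<in> U \<and> U \<subseteq> K" by blast
  qed
  show "Hausdorff_space ladder_space"
    unfolding Hausdorff_space_def topspace_ladder_space
  proof (intro allI impI)
    fix p q assume pq: "p \<in> points f \<and> q \<in> points f \<and> p \<noteq> q"
    then have "\<forall>\<^sub>F n in sequentially. nbhd f p n \<inter> nbhd f q n = {}"
      by (intro eventually_nbhd_disjoint[OF ok _ ok]) auto
    then obtain n where "disjnt (nbhd f p n) (nbhd f q n)"
      unfolding disjnt_def using eventually_happens'[OF sequentially_bot] by blast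
    moreover have "openin ladder_space (nbhd f p n)" "openin ladder_space (nbhd f q n)" "p \<in> nbhd f p n" "q \<in> nbhd f q n"
      using pq by (auto intro: openin_nbhd self_in_nbhd)
    ultimately show "\<exists>U V. openin ladder_space U \<and> openin ladder_space V \<and> p \<in> U \<and> q \<in> V \<and> disjnt U V" by blast
  qed
  show "continuous_map ladder_space euclidean fst"
    unfolding continuous_map_upper_lower_semicontinuous_lt topspace_ladder_space
  proof (intro conjI allI)
    fix \<beta>
    show "openin ladder_space {p \<in> points f. \<beta> < fst p}"
      unfolding openin_ladder_space
    proof (intro conjI ballI)
      fix p assume "p \<in> {p \<in> points f. \<beta> < fst p}"
      then have "p \<in> points f" "\<beta> < fst p" by auto
      then obtain n where "\<forall>y\<in>nbhd f p n. \<beta> < fst y"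
        using level_okD(6)[OF ok, of p \<beta>] by blast
      then have "nbhd f p n \<subseteq> {p \<in> points f. \<beta> < fst p}"
        using nbhd_subset_points[OF \<open>p \<in> points f\<close>, of n] by blast
      then show "\<exists>n. nbhd f p n \<subseteq> {p \<in> points f. \<beta> < fst p}" by blast
    qed blast
    show "openin ladder_space {p \<in> points f. fst p < \<beta>}"
      unfolding openin_ladder_space
    proof (intro conjI ballI)
      fix p assume "p \<in> {p \<in> points f. fst p < \<beta>}"
      then have "nbhd f p 0 \<subseteq> {p \<in> points f. fst p < \<beta>}"
        using nbhd_below(1,2)[OF ok, of p] by force
      then show "\<exists>n. nbhd f p n \<subseteq> {p \<in> points f. fst p < \<beta>}" by blast
    qed blast
  qed
  have "\<alpha> \<in> fst ` points f" for \<alpha>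
    by (rule image_eqI[of _ _ "(\<alpha>, 0)"]) (simp_all add: points_def)
  then show "fst ` topspace ladder_space = UNIV" unfolding topspace_ladder_space by blast
  show "finite {p \<in> topspace ladder_space. fst p = \<alpha>}" for \<alpha>
    by (rule finite_subset[of _ "{\<alpha>} \<times> {..width (f \<alpha>)}"]) (auto simp: topspace_ladder_space points_def)
qed

lemma eventually_climbs_above:
  assumes "climbs lev t \<alpha>" "\<beta> < \<alpha>"
  shows "\<forall>\<^sub>F n in sequentially. \<forall>e\<in>t n. \<beta> < lev e"
proof -
  obtain n d where n: "\<forall>e\<in>t n. \<beta> < lev e" "d \<in> t n"
    using assms unfolding climbs_def by (metis ex_in_conv)
  have "\<beta> < lev e" if "e \<in> t m" "m > n" for e m
  proof -
    have "lev d < lev e" using assms(1) n(2) that unfolding climbs_def by blast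
    then show ?thesis using n by (meson less_trans)
  qed
  then show ?thesis by (intro eventually_sequentiallyI[of "Suc n"]) auto
qed

text \<open>A guess from a subfamily of bounded rank is catchable, so level \<open>\<alpha>\<close> obeys it.  Topologically, the points of
label \<open>j \<ge> 1\<close> then converge to \<open>(\<alpha>, j)\<close>, whereas those of label \<open>0\<close> stay
away from all points of level \<open>\<alpha>\<close>.\<close>

lemma catch:
  assumes unc: "uncountable Z" and fin: "\<And>S. S \<in> Z \<Longrightarrow> finite S" and ne: "{} \<notin> Z"
    and disj: "pairwise disjnt Z"
    and pts: "\<And>S p j. \<lbrakk>S \<in> Z; (p, j) \<in> S\<rbrakk> \<Longrightarrow> p \<in> points f \<and> j \<le> k"
    and label: "\<And>S p i j. \<lbrakk>S \<in> Z; (p, i) \<in> S; (p, j) \<in> S\<rbrakk> \<Longrightarrow> i = j"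
  shows "\<exists>\<alpha>. climbs (fst \<circ> fst) (T \<alpha>) \<alpha> \<and> range (T \<alpha>) \<subseteq> Z \<and>
    (\<forall>n p j. (p, j) \<in> T \<alpha> n \<longrightarrow>
      (if j = 0 then \<forall>i. (\<alpha>, i) \<in> points f \<longrightarrow> p \<notin> nbhd f (\<alpha>, i) 0
       else (\<alpha>, j) \<in> points f \<and> p \<in> nbhd f (\<alpha>, j) n))"
proof -
  \<comment> \<open>Catchable instructions have bounded ranks; since \<open>Z\<close> is uncountable, some bound works for
    uncountably many members.\<close>
  define Zr where "Zr r = {S \<in> Z. \<forall>(p, j)\<in>S. point_rank f p \<le> r}" for r
  have "Z \<subseteq> (\<Union>r. Zr r)"
  proof
    fix S assume S: "S \<in> Z"
    have "\<forall>(p, j)\<in>S. point_rank f p \<le> Max ((\<lambda>(p, j). point_rank f p) ` S)"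
      using fin[OF S] by (auto intro!: Max_ge)
    then show "S \<in> (\<Union>r. Zr r)" using S by (auto simp: Zr_def)
  qed
  then have "\<not> (\<forall>r. countable (Zr r))"
    using unc countable_subset[of Z "\<Union>r. Zr r"] by blast
  then obtain r where "uncountable (Zr r)" by blast
  moreover have sub: "Zr r \<subseteq> Z" by (auto simp: Zr_def)
  ultimately have "\<exists>\<alpha>. climbs (fst \<circ> fst) (T \<alpha>) \<alpha> \<and> range (T \<alpha>) \<subseteq> Zr r"
    using fin ne disj by (intro guess conjI) (auto intro: pairwise_subset)
  then obtain \<alpha> where \<alpha>: "climbs (fst \<circ> fst) (T \<alpha>) \<alpha>" "range (T \<alpha>) \<subseteq> Zr r" by blast
  have inZ: "T \<alpha> n \<in> Z" for n using \<alpha>(2) sub by blast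
  have "point_rank f p \<le> r" if "(p, j) \<in> T \<alpha> n" for p j n
    using \<alpha>(2) that by (fastforce simp: Zr_def)
  moreover have "p \<in> below f \<alpha>" if "(p, j) \<in> T \<alpha> n" for p j n
    using pts[OF inZ that] \<alpha>(1) that unfolding climbs_def below_def by fastforce
  ultimately have "catchable f (T \<alpha>) \<alpha>"
    unfolding catchable_def using \<alpha>(1) pts[OF inZ] label[OF inZ] by blast
  then have "\<forall>n p j. (p, j) \<in> T \<alpha> n \<longrightarrow>
      (if j = 0 then \<forall>i\<le>width (f \<alpha>). p \<notin> nbhd f (\<alpha>, i) 0
       else j \<le> width (f \<alpha>) \<and> p \<in> nbhd f (\<alpha>, j) n)"
    using ok[of \<alpha>] unfolding level_ok_def by blast
  then show ?thesis
    using \<alpha> sub unfolding points_def by (intro exI[of _ \<alpha>]) auto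
qed

end

section \<open>Height\<close>

text \<open>This makes it enough to exhibit accumulation points when showing membership in a successor derivative.\<close>

lemma derived_set_of_cb_derivative:
  "L derived_set_of cb_derivative L \<tau> \<subseteq> cb_derivative L \<tau>"
proof (induction \<tau> rule: less_induct)
  case (less \<tau>)
  have "x \<in> cb_derivative L \<sigma> \<inter> L derived_set_of cb_derivative L \<sigma>"
    if x: "x \<in> L derived_set_of cb_derivative L \<tau>" and "\<sigma> < \<tau>" for x \<sigma>
  proof -
    have "x \<in> L derived_set_of cb_derivative L \<sigma>"
      by (rule subsetD[OF derived_set_of_mono[OF cb_derivative_antimono] x]) (use \<open>\<sigma> < \<tau>\<close> in simp)
    then show ?thesis using less \<open>\<sigma> < \<tau>\<close> by blast
  qed
  moreover have "L derived_set_of cb_derivative L \<tau> \<subseteq> topspace L"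
    by (rule derived_set_of_subset_topspace)
  ultimately show ?case by (subst (2) cb_derivative.simps) blast
qed

lemma is_limit_omega:
  assumes "is_limit (\<alpha> :: omega1)"
  shows "is_limit omega"
  unfolding omega_def using assms by (rule LeastI)

lemma below_omega_cases:
  assumes "\<sigma> < omega"
  obtains "\<And>\<tau>. \<sigma> \<le> \<tau>" | \<tau> where "\<tau> < \<sigma>" "\<And>\<upsilon>. \<upsilon> < \<sigma> \<Longrightarrow> \<upsilon> \<le> \<tau>"
proof -
  have "\<not> is_limit \<sigma>" using assms not_less_Least unfolding omega_def by blast
  then show thesis using that unfolding is_limit_def by (meson not_less)
qed

lemma uncountable_if_unbounded:
  assumes "\<And>\<beta> :: omega1. \<exists>x\<in>D. \<beta> < lev x"
  shows "uncountable D"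
proof
  assume "countable D"
  then have "countable (\<Union>x\<in>D. {..<lev x})" using countable_lessThan_omega1 by blast
  moreover have "(\<Union>x\<in>D. {..<lev x}) = UNIV" using assms by blast
  ultimately show False using uncountable_UNIV_omega1 by simp
qed

lemma ex_greater_omega1: "\<exists>\<gamma> :: omega1. \<beta> < \<gamma>"
proof (rule ccontr)
  assume "\<not> ?thesis"
  then have "UNIV = insert \<beta> {..<\<beta>}" by (auto simp: not_less order_le_less)
  then show False using uncountable_UNIV_omega1 countable_lessThan_omega1 by (metis countable_insert)
qed

context guided_levels
begin

text \<open>A point of the next derivative has, in its neighbourhood, another point of the given one, and the rank
drops strictly towards that point.\<close>

lemma cb_derivative_rank:
  assumes "is_limit omega"
  shows "\<exists>\<sigma><omega. \<forall>p\<in>cb_derivative ladder_space \<sigma>. n \<le> point_rank f p"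
proof (induction n)
  case 0
  show ?case using assms by (auto simp: is_limit_def)
next
  case (Suc n)
  then obtain \<sigma> where \<sigma>: "\<sigma> < omega" "\<forall>p\<in>cb_derivative ladder_space \<sigma>. n \<le> point_rank f p" by blast
  then obtain \<tau> where \<tau>: "\<sigma> < \<tau>" "\<tau> < omega" using assms unfolding is_limit_def by blast
  have "Suc n \<le> point_rank f p" if "p \<in> cb_derivative ladder_space \<tau>" for p
  proof -
    have p: "p \<in> ladder_space derived_set_of cb_derivative ladder_space \<sigma>" "p \<in> points f"
      using that \<tau>(1) unfolding cb_derivative.simps[of ladder_space \<tau>] topspace_ladder_space by auto
    moreover have "p \<in> nbhd f p 0" "openin ladder_space (nbhd f p 0)"
      using p(2) by (simp_all add: self_in_nbhd openin_nbhd)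
    ultimately obtain y where y: "y \<noteq> p" "y \<in> cb_derivative ladder_space \<sigma>" "y \<in> nbhd f p 0"
      unfolding derived_set_of_def by blast
    have "point_rank f y < point_rank f p" using level_okD(4)[OF ok p(2) y(3,1)] .
    then show ?thesis using \<sigma>(2) y(2) by fastforce
  qed
  then show ?case using \<tau>(2) by blast
qed

text \<open>Unboundedness, rather than mere nonemptiness, is the right induction hypothesis: it makes the derivative
uncountable, so that its singletons form a family to which \<open>catch\<close> applies.\<close>

lemma cb_derivative_unbounded:
  "\<sigma> < omega \<Longrightarrow> \<exists>p\<in>cb_derivative ladder_space \<sigma>. \<beta> < fst p"
proof (induction \<sigma> arbitrary: \<beta> rule: less_induct)
  case (less \<sigma>)
  from less.prems show ?case
  proof (cases rule: below_omega_cases)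
    case 1
    obtain \<gamma> where "\<beta> < \<gamma>" using ex_greater_omega1 by blast
    moreover have "(\<gamma>, 0) \<in> cb_derivative ladder_space \<sigma>"
      unfolding cb_derivative_zero[OF 1] topspace_ladder_space by (simp add: points_def)
    ultimately show ?thesis by force
  next
    case (2 \<tau>)
    define D where "D = {p \<in> cb_derivative ladder_space \<tau>. \<beta> < fst p}"
    have "\<tau> < omega" using 2(1) less.prems by (rule less_trans)
    have D_points: "D \<subseteq> points f"
      unfolding D_def using cb_derivative.simps[of ladder_space \<tau>] topspace_ladder_space by blast
    have "uncountable D"
    proof (rule uncountable_if_unbounded)
      fix \<gamma>
      obtain p where "p \<in> cb_derivative ladder_space \<tau>" "max \<beta> \<gamma> < fst p"
        using less.IH[OF 2(1) \<open>\<tau> < omega\<close>] by blast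
      then show "\<exists>p\<in>D. \<gamma> < fst p" by (intro bexI[of _ p]) (simp_all add: D_def)
    qed
    define Z where "Z = (\<lambda>p. {(p, 1 :: nat)}) ` D"
    have "uncountable Z"
      unfolding Z_def using \<open>uncountable D\<close> by (auto dest: countable_image_inj_on simp: inj_on_def)
    then have "\<exists>\<alpha>. climbs (fst \<circ> fst) (T \<alpha>) \<alpha> \<and> range (T \<alpha>) \<subseteq> Z \<and>
      (\<forall>n p j. (p, j) \<in> T \<alpha> n \<longrightarrow>
        (if j = 0 then \<forall>i. (\<alpha>, i) \<in> points f \<longrightarrow> p \<notin> nbhd f (\<alpha>, i) 0
         else (\<alpha>, j) \<in> points f \<and> p \<in> nbhd f (\<alpha>, j) n))"
      using D_points by (intro catch[of Z 1]) (auto simp: Z_def pairwise_def disjnt_def)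
    then obtain \<alpha> where climb: "climbs (fst \<circ> fst) (T \<alpha>) \<alpha>" and TZ: "range (T \<alpha>) \<subseteq> Z"
      and limit: "\<And>n p. (p, 1) \<in> T \<alpha> n \<Longrightarrow> (\<alpha>, 1) \<in> points f \<and> p \<in> nbhd f (\<alpha>, 1) n"
      by auto
    have "\<exists>p\<in>D. T \<alpha> n = {(p, 1)}" for n using TZ unfolding Z_def by blast
    then obtain p where p: "\<And>n. p n \<in> D" "\<And>n. T \<alpha> n = {(p n, 1)}" by metis
    have lev: "fst (p n) < \<alpha>" for n using climb p(2) by (simp add: climbs_def)
    have lim: "(\<alpha>, 1) \<in> points f" "p n \<in> nbhd f (\<alpha>, 1) n" for n using limit[of "p n" n] p(2) by auto
    have "\<exists>y\<noteq>(\<alpha>, 1). y \<in> cb_derivative ladder_space \<tau> \<and> y \<in> U" if U: "(\<alpha>, 1) \<in> U" "openin ladder_space U" for U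
    proof -
      obtain n where "nbhd f (\<alpha>, 1) n \<subseteq> U" using U unfolding openin_ladder_space by blast
      then have "p n \<in> U" using lim(2) by blast
      moreover have "p n \<noteq> (\<alpha>, 1)" using lev[of n] by auto
      moreover have "p n \<in> cb_derivative ladder_space \<tau>" using p(1) by (simp add: D_def)
      ultimately show ?thesis by blast
    qed
    then have "(\<alpha>, 1) \<in> ladder_space derived_set_of cb_derivative ladder_space \<tau>"
      using lim(1) by (simp add: derived_set_of_def topspace_ladder_space)
    then have "(\<alpha>, 1) \<in> cb_derivative ladder_space \<sigma>"
      using cb_derivative_successor[OF 2, of ladder_space] derived_set_of_cb_derivative[of ladder_space \<tau>] by blast
    moreover have "\<beta> < \<alpha>" using p(1)[of 0] lev[of 0] by (auto simp: D_def)
    ultimately show ?thesis by force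
  qed
qed

lemma has_height_ladder_space:
  assumes "is_limit omega"
  shows "has_height ladder_space omega"
  unfolding has_height_def
proof (intro conjI allI impI)
  have "p \<notin> cb_derivative ladder_space omega" for p
  proof
    assume p: "p \<in> cb_derivative ladder_space omega"
    obtain \<sigma> where \<sigma>: "\<sigma> < omega" "\<forall>q\<in>cb_derivative ladder_space \<sigma>. Suc (point_rank f p) \<le> point_rank f q"
      using cb_derivative_rank[OF assms] by blast
    have "p \<in> cb_derivative ladder_space \<sigma>" by (rule subsetD[OF cb_derivative_antimono p]) (use \<sigma>(1) in simp)
    then show False using \<sigma>(2) by fastforce
  qed
  then show "cb_derivative ladder_space omega = {}" by blast
  show "cb_derivative ladder_space \<sigma> \<noteq> {}" if "\<sigma> < omega" for \<sigma>
    using cb_derivative_unbounded[OF that] by blast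
qed

end

section \<open>The collapsing property\<close>

lemma openin_Alexandroff_Some:
  assumes "openin (Alexandroff_compactification L) U" "Some x \<in> U"
  obtains V where "openin L V" "x \<in> V" "Some ` V \<subseteq> U"
proof -
  from assms(1) consider V where "openin L V" "U = Some ` V"
    | C where "compactin L C" "closedin L C" "U = insert None (Some ` (topspace L - C))"
    unfolding openin_Alexandroff_compactification by blast
  then show thesis
  proof cases
    case 1
    then show thesis using assms(2) by (intro that[of V]) auto
  next
    case 2
    then show thesis using assms(2) by (intro that[of "topspace L - C"]) auto
  qed
qed

lemma openin_Alexandroff_None:
  assumes "openin (Alexandroff_compactification L) U" "None \<in> U"
  obtains C where "compactin L C" "U = insert None (Some ` (topspace L - C))"
  using assms unfolding openin_Alexandroff_compactification by blast

lemma ordered_partition_index: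
  assumes part: "ordered_partition m k I" and "m \<ge> 1"
  shows "k \<ge> 1 \<and> (\<exists>idx. (\<forall>j\<in>{1..k}. I j \<noteq> {} \<and> I j = {i \<in> {1..m}. idx i = j}) \<and>
    (\<forall>i\<in>{1..m}. idx i \<in> {1..k}))"
proof -
  have inj: "inj_on I {1..k}" and Un: "\<Union>(I ` {1..k}) = {1..m}" and disj: "disjoint (I ` {1..k})"
    and ne: "{} \<notin> I ` {1..k}"
    using part by (auto simp: ordered_partition_def partition_on_def)
  define idx where "idx i = (SOME j. j \<in> {1..k} \<and> i \<in> I j)" for i
  have idx: "idx i \<in> {1..k} \<and> i \<in> I (idx i)" if "i \<in> {1..m}" for i
    unfolding idx_def by (rule someI_ex) (use Un that in blast)
  have "idx i = j" if "j \<in> {1..k}" "i \<in> I j" for i j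
  proof (rule ccontr)
    assume "idx i \<noteq> j"
    have "i \<in> {1..m}" using that Un by blast
    from idx[OF this] have "I (idx i) \<noteq> I j" using inj that(1) \<open>idx i \<noteq> j\<close> by (metis inj_onD)
    then have "I (idx i) \<inter> I j = {}"
      using disj idx[OF \<open>i \<in> {1..m}\<close>] that(1) unfolding pairwise_def disjnt_def by blast
    then show False using idx[OF \<open>i \<in> {1..m}\<close>] that(2) by blast
  qed
  then have I: "I j = {i \<in> {1..m}. idx i = j}" if "j \<in> {1..k}" for j
    using idx Un that by blast
  have "1 \<in> {1..m}" using \<open>m \<ge> 1\<close> by simp
  then have "k \<ge> 1" using idx[of 1] by auto
  show ?thesis
  proof (intro conjI exI[of _ idx] ballI)
    show "1 \<le> k" by fact
    show "I j \<noteq> {}" "I j = {i \<in> {1..m}. idx i = j}" if "j \<in> {1..k}" for j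
      using I[OF that] ne that by blast+
    show "idx i \<in> {1..k}" if "i \<in> {1..m}" for i using idx[OF that] by blast
  qed
qed

context guided_levels
begin

text \<open>Every point \<open>y\<close> has a neighbourhood that is eventually missed: below level \<open>\<alpha>\<close> because the sequence climbs past
the level of \<open>y\<close>, at level \<open>\<alpha>\<close> by hypothesis, and above because neighbourhoods may be taken above \<open>\<alpha>\<close>.
Finitely many of these cover the compact set.\<close>

lemma eventually_outside_compact:
  assumes climb: "climbs (fst \<circ> fst) (T \<alpha>) \<alpha>"
    and away: "\<And>n p i. \<lbrakk>(p, 0) \<in> T \<alpha> n; (\<alpha>, i) \<in> points f\<rbrakk> \<Longrightarrow> p \<notin> nbhd f (\<alpha>, i) 0"
    and "compactin ladder_space C"
  shows "\<forall>\<^sub>F n in sequentially. \<forall>p. (p, 0) \<in> T \<alpha> n \<longrightarrow> p \<notin> C"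
proof -
  have T: "fst p < \<alpha>" if "(p, j) \<in> T \<alpha> n" for p j n
    using climb that unfolding climbs_def by fastforce
  have "\<exists>l. \<forall>\<^sub>F n in sequentially. \<forall>p. (p, 0) \<in> T \<alpha> n \<longrightarrow> p \<notin> nbhd f y l" if y: "y \<in> points f" for y
  proof (cases "fst y" \<alpha> rule: linorder_cases)
    case less
    have "\<forall>\<^sub>F n in sequentially. \<forall>p. (p, 0) \<in> T \<alpha> n \<longrightarrow> p \<notin> nbhd f y 0"
      using eventually_climbs_above[OF climb less]
      by eventually_elim (use nbhd_below(2)[OF ok y] in fastforce)
    then show ?thesis by blast
  next
    case equal
    then have "(p, 0) \<in> T \<alpha> n \<Longrightarrow> p \<notin> nbhd f y 0" for p n
      using away[of p n "snd y"] y by (cases y) auto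
    then show ?thesis by (intro exI[of _ 0]) simp
  next
    case greater
    then obtain l where "\<forall>z\<in>nbhd f y l. \<alpha> < fst z" using level_okD(6)[OF ok y] by blast
    then have "(p, 0) \<in> T \<alpha> n \<Longrightarrow> p \<notin> nbhd f y l" for p n using T[of p 0 n] by auto
    then show ?thesis by (intro exI[of _ l]) simp
  qed
  then have "\<forall>y\<in>points f. \<exists>l. \<forall>\<^sub>F n in sequentially. \<forall>p. (p, 0) \<in> T \<alpha> n \<longrightarrow> p \<notin> nbhd f y l"
    by blast
  from bchoice[OF this] obtain l where
    l: "\<forall>y\<in>points f. \<forall>\<^sub>F n in sequentially. \<forall>p. (p, 0) \<in> T \<alpha> n \<longrightarrow> p \<notin> nbhd f y (l y)"
    by blast
  have C: "C \<subseteq> points f" using compactin_subset_topspace[OF assms(3)] by (simp add: topspace_ladder_space)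
  have "\<exists>\<F>. finite \<F> \<and> \<F> \<subseteq> (\<lambda>y. nbhd f y (l y)) ` C \<and> C \<subseteq> \<Union>\<F>"
  proof (rule compactinD[OF assms(3)])
    show "openin ladder_space U" if "U \<in> (\<lambda>y. nbhd f y (l y)) ` C" for U
      using that C openin_nbhd by blast
    have "y \<in> nbhd f y (l y)" if "y \<in> C" for y
      using that C by (intro self_in_nbhd) blast
    then show "C \<subseteq> \<Union>((\<lambda>y. nbhd f y (l y)) ` C)" by blast
  qed
  then obtain \<F> where \<F>: "finite \<F>" "\<F> \<subseteq> (\<lambda>y. nbhd f y (l y)) ` C" "C \<subseteq> \<Union>\<F>" by blast
  from finite_subset_image[OF \<F>(1,2)] obtain F where
    F: "F \<subseteq> C" "finite F" "\<F> = (\<lambda>y. nbhd f y (l y)) ` F" by blast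
  have "\<forall>\<^sub>F n in sequentially. \<forall>y\<in>F. \<forall>p. (p, 0) \<in> T \<alpha> n \<longrightarrow> p \<notin> nbhd f y (l y)"
    using F(1,2) C l by (intro eventually_ball_finite) auto
  then show ?thesis by eventually_elim (use F(3) \<F>(3) in blast)
qed

text \<open>The \<open>i\<close>-th coordinate of a tuple is labelled by the index of its block, except that the last block has
label \<open>0\<close>.  Separatedness makes the labels of a tuple well defined on points and the labelled sets of different
tuples disjoint.\<close>

lemma collapsing_property_ladder_space: "collapsing_property ladder_space"
  unfolding collapsing_property_def
proof (intro allI impI)
  fix m k :: nat and I and A :: "(nat \<Rightarrow> point) set"
  assume m: "1 \<le> m" and part: "ordered_partition m k I" and A: "A \<subseteq> {1..m} \<rightarrow>\<^sub>E topspace ladder_space"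
    and us: "uncountable A \<and> partition_separated ladder_space k I A"
  have unc: "uncountable A" and sep: "partition_separated ladder_space k I A" by (rule conjunct1[OF us], rule conjunct2[OF us])
  note index = ordered_partition_index[OF part m]
  have k: "k \<ge> 1" by (rule conjunct1[OF index])
  obtain idx where I': "\<forall>j\<in>{1..k}. I j \<noteq> {} \<and> I j = {i \<in> {1..m}. idx i = j}"
    and idx': "\<forall>i\<in>{1..m}. idx i \<in> {1..k}"
    using conjunct2[OF index] by (elim exE conjE)
  note I = bspec[OF I'] and idx = bspec[OF idx']
  have disj: "x i \<noteq> y i'"
    if "x \<in> A" "y \<in> A" "i \<in> {1..m}" "i' \<in> {1..m}" "x \<noteq> y \<or> idx i \<noteq> idx i'" for x y i i'
  proof -
    have "\<forall>x\<in>A. \<forall>y\<in>A. \<forall>j'\<in>{1..k}. \<forall>j\<in>{1..k}. j' \<noteq> j \<or> x \<noteq> y \<longrightarrow> x ` I j \<inter> y ` I j' = {}"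
      using sep unfolding partition_separated_def k_separated_def by blast
    then have "x ` I (idx i) \<inter> y ` I (idx i') = {}"
      using that idx by blast
    moreover have "i \<in> I (idx i)" "i' \<in> I (idx i')" using I idx that by blast+
    ultimately show ?thesis by blast
  qed
  have A_points: "x i \<in> points f" if "x \<in> A" "i \<in> {1..m}" for x i
    using subsetD[OF A that(1)] that(2) unfolding topspace_ladder_space by (rule PiE_mem)
  define lab where "lab i = (if idx i = k then 0 else idx i)" for i
  define enc where "enc x = (\<lambda>i. (x i, lab i)) ` {1..m}" for x :: "nat \<Rightarrow> point"
  have enc_ne: "enc x \<noteq> {}" for x using m by (simp add: enc_def)
  have enc_disj: "enc x \<inter> enc y = {}" if "x \<in> A" "y \<in> A" "x \<noteq> y" for x y
  proof -
    have "x i \<noteq> y i'" if "i \<in> {1..m}" "i' \<in> {1..m}" for i i'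
      using disj \<open>x \<in> A\<close> \<open>y \<in> A\<close> \<open>x \<noteq> y\<close> that by blast
    then show ?thesis unfolding enc_def by blast
  qed
  have "inj_on enc A"
  proof (rule inj_onI, rule ccontr)
    fix x y assume "x \<in> A" "y \<in> A" "enc x = enc y" "x \<noteq> y"
    then show False using enc_disj[of x y] enc_ne[of x] by simp
  qed
  then have "uncountable (enc ` A)" using unc countable_image_inj_on[of enc A] by auto
  then have "\<exists>\<alpha>. climbs (fst \<circ> fst) (T \<alpha>) \<alpha> \<and> range (T \<alpha>) \<subseteq> enc ` A \<and>
    (\<forall>n p j. (p, j) \<in> T \<alpha> n \<longrightarrow>
      (if j = 0 then \<forall>i. (\<alpha>, i) \<in> points f \<longrightarrow> p \<notin> nbhd f (\<alpha>, i) 0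
       else (\<alpha>, j) \<in> points f \<and> p \<in> nbhd f (\<alpha>, j) n))"
  proof (rule catch[where k = k])
    show "finite S" if "S \<in> enc ` A" for S using that by (auto simp: enc_def)
    show "{} \<notin> enc ` A" using enc_ne by auto
    show "pairwise disjnt (enc ` A)"
    proof (rule pairwiseI)
      fix S S' assume "S \<in> enc ` A" "S' \<in> enc ` A" "S \<noteq> S'"
      then obtain x y where "x \<in> A" "y \<in> A" "S = enc x" "S' = enc y" by blast
      then show "disjnt S S'" unfolding disjnt_def using enc_disj[of x y] \<open>S \<noteq> S'\<close> by blast
    qed
  next
    fix S p j assume "S \<in> enc ` A" "(p, j) \<in> S"
    then obtain x i where "x \<in> A" "i \<in> {1..m}" "p = x i" "j = lab i" by (auto simp: enc_def)
    then show "p \<in> points f \<and> j \<le> k"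
      using A_points[of x i] idx[of i] by (simp add: lab_def)
  next
    fix S p i j assume "S \<in> enc ` A" "(p, i) \<in> S" "(p, j) \<in> S"
    then obtain x a b where x: "x \<in> A" "a \<in> {1..m}" "p = x a" "i = lab a" "b \<in> {1..m}" "p = x b" "j = lab b"
      by (auto simp: enc_def)
    then have "idx a = idx b" using disj[of x x a b] by auto
    then show "i = j" using x by (simp add: lab_def)
  qed
  then obtain \<alpha> where climb: "climbs (fst \<circ> fst) (T \<alpha>) \<alpha>" and TA: "range (T \<alpha>) \<subseteq> enc ` A"
    and caught: "\<And>n p j. (p, j) \<in> T \<alpha> n \<Longrightarrow>
      (if j = 0 then \<forall>i. (\<alpha>, i) \<in> points f \<longrightarrow> p \<notin> nbhd f (\<alpha>, i) 0
       else (\<alpha>, j) \<in> points f \<and> p \<in> nbhd f (\<alpha>, j) n)"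
    by blast
  have "\<exists>x\<in>A. T \<alpha> n = enc x" for n using TA by blast
  then obtain x where xA: "\<And>n. x n \<in> A" and xT: "\<And>n. T \<alpha> n = enc (x n)" by metis
  have xT': "(x n i, lab i) \<in> T \<alpha> n" if "i \<in> {1..m}" for n i
    using that unfolding xT enc_def by blast
  have x_points: "x n i \<in> points f" if "i \<in> {1..m}" for n i
    using A_points[OF xA that] .
  define a where "a j = (if j = k then None else Some (\<alpha>, j))" for j
  define q where "q = (\<lambda>i\<in>{1..m}. a (idx i))"
  have near: "(\<alpha>, idx i) \<in> points f \<and> x n i \<in> nbhd f (\<alpha>, idx i) n" if "i \<in> {1..m}" "idx i \<noteq> k" for i n
    using caught[OF xT'[OF that(1), of n]] that(2) idx[OF that(1)] by (auto simp: lab_def split: if_splits)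
  have a_top: "a (idx i) \<in> topspace (Alexandroff_compactification ladder_space)" if "i \<in> {1..m}" for i
    using near[OF that, of 0] by (auto simp: a_def topspace_ladder_space)
  have q_I: "q ` I j = {a j}" if "j \<in> {1..k}" for j
    using I[OF that] unfolding q_def by auto
  have away: "p \<notin> nbhd f (\<alpha>, i) 0" if "(p, 0) \<in> T \<alpha> n" "(\<alpha>, i) \<in> points f" for n p i
    using caught[OF that(1)] that(2) by simp
  have conv: "\<forall>\<^sub>F n in sequentially. Some (x n i) \<in> U"
    if i: "i \<in> {1..m}" and U: "openin (Alexandroff_compactification ladder_space) U" "q i \<in> U" for i U
  proof (cases "idx i = k")
    case True
    then have "None \<in> U" using U(2) i by (simp add: q_def a_def)
    from openin_Alexandroff_None[OF U(1) this] obtain C where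
      C: "compactin ladder_space C" "U = insert None (Some ` (topspace ladder_space - C))" .
    have "\<forall>\<^sub>F n in sequentially. \<forall>p. (p, 0) \<in> T \<alpha> n \<longrightarrow> p \<notin> C"
      by (rule eventually_outside_compact[OF climb away C(1)])
    then show ?thesis
    proof eventually_elim
      case (elim n)
      have "(x n i, 0) \<in> T \<alpha> n" using xT'[OF i, of n] True by (simp add: lab_def)
      then have "x n i \<notin> C" using elim by blast
      then show ?case using C(2) x_points[OF i, of n] by (simp add: topspace_ladder_space)
    qed
  next
    case False
    then have "Some (\<alpha>, idx i) \<in> U" using U(2) i by (simp add: q_def a_def)
    from openin_Alexandroff_Some[OF U(1) this] obtain V where
      V: "openin ladder_space V" "(\<alpha>, idx i) \<in> V" "Some ` V \<subseteq> U" .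
    then obtain l where l: "nbhd f (\<alpha>, idx i) l \<subseteq> V" unfolding openin_ladder_space by blast
    have "x n i \<in> V" if "n \<ge> l" for n
    proof -
      have "nbhd f (\<alpha>, idx i) n \<subseteq> nbhd f (\<alpha>, idx i) l"
        by (rule antimono) (use near[OF i False] that in auto)
      then show ?thesis using near[OF i False, of n] l by blast
    qed
    then show ?thesis using V(3) by (intro eventually_sequentiallyI[of l]) auto
  qed
  let ?P = "product_topology (\<lambda>_. Alexandroff_compactification ladder_space) {1..m}"
  let ?B = "(\<lambda>x. \<lambda>i\<in>{1..m}. Some (x i)) ` A"
  have "\<exists>y\<noteq>q. y \<in> ?B \<and> y \<in> W" if W: "q \<in> W" "openin ?P W" for W
  proof -
    have "\<exists>U. (\<forall>i\<in>{1..m}. openin (Alexandroff_compactification ladder_space) (U i)) \<and>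
        q \<in> Pi\<^sub>E {1..m} U \<and> Pi\<^sub>E {1..m} U \<subseteq> W"
      using W(2)[unfolded openin_product_topology_alt, THEN bspec, OF W(1)] by blast
    then obtain U where U: "\<forall>i\<in>{1..m}. openin (Alexandroff_compactification ladder_space) (U i)"
      "q \<in> Pi\<^sub>E {1..m} U" "Pi\<^sub>E {1..m} U \<subseteq> W"
      by blast
    have "\<forall>\<^sub>F n in sequentially. \<forall>i\<in>{1..m}. Some (x n i) \<in> U i"
      using U(1) PiE_mem[OF U(2)] by (intro eventually_ball_finite ballI conv) auto
    then obtain n where n: "\<forall>i\<in>{1..m}. Some (x n i) \<in> U i"
      using eventually_happens'[OF sequentially_bot] by blast
    let ?y = "\<lambda>i\<in>{1..m}. Some (x n i)"
    have "?y \<in> Pi\<^sub>E {1..m} U" using n by auto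
    then have "?y \<in> W" using U(3) by blast
    moreover have "?y \<in> ?B" using xA[of n] by blast
    \<comment> \<open>The limit takes the value \<open>\<infinity>\<close> on the last block, which is nonempty, and the tuples never do.\<close>
    moreover have "?y \<noteq> q"
    proof -
      obtain i where "i \<in> {1..m}" "idx i = k" using I[of k] k by auto
      then have "?y i \<noteq> q i" by (simp add: q_def a_def)
      then show ?thesis by metis
    qed
    ultimately show ?thesis by blast
  qed
  moreover have "q \<in> topspace ?P"
    using a_top by (auto simp: q_def simp del: topspace_Alexandroff_compactification)
  ultimately have "q \<in> ?P derived_set_of ?B" by (simp add: derived_set_of_def)
  moreover have "a ` {1..k} \<subseteq> topspace (Alexandroff_compactification ladder_space)"
  proof
    fix b assume "b \<in> a ` {1..k}"
    then obtain j where j: "j \<in> {1..k}" "b = a j" by blast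
    then obtain i where "i \<in> {1..m}" "idx i = j" using I[of j] by blast
    then show "b \<in> topspace (Alexandroff_compactification ladder_space)" using a_top j by blast
  qed
  moreover have "inj_on a {1..k}" by (auto simp: inj_on_def a_def split: if_splits)
  moreover have "a k = None" by (simp add: a_def)
  moreover have "\<forall>j\<in>{1..k}. q ` I j = {a j}" using q_I by blast
  ultimately show "collapses ladder_space m k I A"
    unfolding collapses_def by (intro bexI[of _ q] exI[of _ a] conjI)
qed

end

theorem theorem3p6:
  assumes "clubsuit"
  shows "\<exists>L :: (omega1 \<times> nat) topology.
           class_S L \<and> has_height L omega \<and> collapsing_property L"
proof -
  \<comment> \<open>Labelled points are coded by ordinals, as sequence guessing requires.\<close>
  obtain p :: "omega1 \<times> omega1 \<Rightarrow> omega1" where p: "inj p"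
    by (rule inj_pairing_omega1)
  have "infinite (UNIV :: omega1 set)"
    using uncountable_UNIV_omega1 uncountable_infinite by blast
  then obtain e :: "nat \<Rightarrow> omega1" where e: "inj e"
    using infinite_countable_subset by blast
  define g where "g = (\<lambda>((\<alpha>, i), j). p (p (\<alpha>, e i), e j))"
  have "inj g"
    by (rule injI) (auto simp: g_def dest!: injD[OF p] injD[OF e])
  moreover have "countable {q :: point \<times> nat. (fst \<circ> fst) q \<le> \<beta>}" for \<beta>
  proof -
    have "countable (insert \<beta> {..<\<beta>})" using countable_lessThan_omega1 by simp
    then have "countable ((insert \<beta> {..<\<beta>} \<times> (UNIV :: nat set)) \<times> (UNIV :: nat set))" by simp
    then show ?thesis by (rule countable_subset[rotated]) (auto simp: order_le_less)
  qed
  ultimately have "\<exists>T :: omega1 \<Rightarrow> nat \<Rightarrow> (point \<times> nat) set. \<forall>Z.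
      uncountable Z \<and> (\<forall>S\<in>Z. finite S) \<and> {} \<notin> Z \<and> pairwise disjnt Z \<longrightarrow>
        (\<exists>\<alpha>. climbs (fst \<circ> fst) (T \<alpha>) \<alpha> \<and> range (T \<alpha>) \<subseteq> Z)"
    by (rule clubsuit_guesses_sequences[OF assms])
  then obtain T :: "omega1 \<Rightarrow> nat \<Rightarrow> (point \<times> nat) set" where
    T: "\<And>Z. uncountable Z \<and> (\<forall>S\<in>Z. finite S) \<and> {} \<notin> Z \<and> pairwise disjnt Z \<Longrightarrow>
      \<exists>\<alpha>. climbs (fst \<circ> fst) (T \<alpha>) \<alpha> \<and> range (T \<alpha>) \<subseteq> Z"
    by blast
  obtain f where f: "\<And>\<alpha>. level_ok f (T \<alpha>) \<alpha>" using levels_exist by blast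
  interpret guided_levels T f
  proof
    show "level_ok f (T \<alpha>) \<alpha>" for \<alpha> by (rule f)
    show "\<exists>\<alpha>. climbs (fst \<circ> fst) (T \<alpha>) \<alpha> \<and> range (T \<alpha>) \<subseteq> Z"
      if "uncountable Z \<and> (\<forall>S\<in>Z. finite S) \<and> {} \<notin> Z \<and> pairwise disjnt Z" for Z
      using that by (rule T)
  qed
  have "\<exists>\<alpha> :: omega1. is_limit \<alpha>"
    using assms uncountable_UNIV_omega1 unfolding clubsuit_def by blast
  then have "has_height ladder_space omega" using is_limit_omega has_height_ladder_space by blast
  then have "class_S ladder_space \<and> has_height ladder_space omega \<and> collapsing_property ladder_space"
    using class_S_ladder_space collapsing_property_ladder_space by simp
  then show ?thesis ..
qed

end
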